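(* Let $\mathbb{K}$ be $\mathbb{R}$ or $\mathbb{C}$, let $p\ge q\ge 1$ be fixed integers, and let $M\in\mathbb{K}^{q\times p}$ be a fixed matrix of full rank $q$ (so $M$ is invertible if $p=q$, and surjective if $p>q$). For $n\ge 1$ let $\operatorname{TM}_{\langle n\rangle,p,q}:\mathbb{K}^{n\times n\times p}\times\mathbb{K}^{n\times n\times p}\to\mathbb{K}^{n\times n\times p}$, $(\mathcal{A},\mathcal{B})\mapsto \mathcal{A}*_M\mathcal{B}$, be the tensor-tensor multiplication with $M$. Then $$\widehat{\omega}(\operatorname{TM}_{\langle n\rangle,p,q})=\omega(\operatorname{TM}_{\langle n\rangle,p,q}),$$ where $\widehat{\omega}$ is the asymptotic exponent on the total complexity and $\omega$ is the asymptotic exponent on the tensor rank.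
   Context: Mode-3 product: for $\mathcal{A}=[a_{ijk}]\in\mathbb{K}^{m\times n\times p}$ and $N=[n_{kl}]\in\mathbb{K}^{r\times p}$, $\mathcal{A}\times_3 N\in\mathbb{K}^{m\times n\times r}$ has entries $(\mathcal{A}\times_3 N)_{ijk}=\sum_{l=1}^p n_{kl}a_{ijl}$. The $i$-th frontal slice $\mathcal{A}^{(i)}$ of $\mathcal{A}\in\mathbb{K}^{m\times n\times p}$ is the $m\times n$ matrix with entries $a_{\cdot\,\cdot\, i}$. Face-wise product: $(\mathcal{A}\triangle\mathcal{B})^{(i)}=\mathcal{A}^{(i)}\mathcal{B}^{(i)}$ for all $i$. Tensor-tensor multiplication: for $M\in\mathbb{K}^{q\times p}$ of full rank $q\le p$, $\mathcal{A}*_M\mathcal{B}=((\mathcal{A}\times_3 M)\triangle(\mathcal{B}\times_3 M))\times_3 M^+$, where $M^+=M^H(MM^H)^{-1}$ is the Moore-Penrose inverse ($M^+=M^{-1}$ if $p=q$). This map is bilinear over $\mathbb{K}$. Tensor rank: for a bilinear map $T:U\times V\to W$ of finite-dimensional $\mathbb{K}$-vector spaces, $\mathbf{R}(T)$ is the least $r$ such that $T(u,v)=\sum_{i=1}^r\alpha_i(u)\beta_i(v)w_i$ for some $\alpha_i\in U^*$, $\beta_i\in V^*$, $w_i\in W$. For a sequence $(T_n)$ of bilinear maps, $\omega(T_n)=\inf\{\tau\mid \mathbf{R}(T_n)=O(n^\tau)\}$. Total complexity: for a rational map $\varphi=(\varphi_1,\dots,\varphi_b):\mathbb{K}^a\to\mathbb{K}^b$,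 $\mathbf{L}(\varphi)$ is the minimal total number of arithmetic operations (additions, subtractions, multiplications, divisions, and multiplications by constants of $\mathbb{K}$, each of cost one) in a straight-line program over $\mathbb{K}$ that computes all of $\varphi_1,\dots,\varphi_b$ from the input variables (coordinates on $\mathbb{K}^a$) and constants of $\mathbb{K}$. For a sequence $(\varphi_n)$ of rational maps, $\widehat{\omega}(\varphi_n)=\inf\{\tau\mid\mathbf{L}(\varphi_n)=O(n^\tau)\}$. *)

theory Defs
  imports
    "HOL-Library.Landau_Symbols"
    "HOL-Library.Extended_Real"
    "HOL-Library.Function_Algebras"
    "HOL-Library.Poly_Mapping"
    "HOL-Library.Countable"
    "HOL-Computational_Algebra.Fraction_Field"
    "Jordan_Normal_Form.Schur_Decomposition"
    "Jordan_Normal_Form.DL_Rank"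
begin

subsection \<open>Coordinate spaces and tensors\<close>

text \<open>The space \<open>K\<^sup>I\<close>: families indexed by \<open>I\<close>, extended by zero to the whole index type.
  Addition is the pointwise one of \<^theory>\<open>HOL-Library.Function_Algebras\<close>.\<close>

definition coord_space :: "'i set \<Rightarrow> ('i \<Rightarrow> 'k::zero) set" where
  "coord_space I = {x. \<forall>i. i \<notin> I \<longrightarrow> x i = 0}"

definition coord_scale :: "'k::times \<Rightarrow> ('i \<Rightarrow> 'k) \<Rightarrow> 'i \<Rightarrow> 'k" where
  "coord_scale c x = (\<lambda>i. c * x i)"

text \<open>Indices of tensor entries and of frontal slices start at 0.\<close>

type_synonym 'k tensor = "nat \<times> nat \<times> nat \<Rightarrow> 'k"

definition tensor_index :: "nat \<Rightarrow> nat \<Rightarrow> nat \<Rightarrow> (nat \<times> nat \<times> nat) set" where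
  "tensor_index m n p = {..<m} \<times> {..<n} \<times> {..<p}"

abbreviation tensor_space :: "nat \<Rightarrow> nat \<Rightarrow> nat \<Rightarrow> 'k::zero tensor set" where
  "tensor_space m n p \<equiv> coord_space (tensor_index m n p)"

definition mode3_product :: "'k::comm_ring_1 tensor \<Rightarrow> 'k mat \<Rightarrow> 'k tensor" where
  "mode3_product A N =
     (\<lambda>(i, j, k). if k < dim_row N then (\<Sum>l<dim_col N. N $$ (k, l) * A (i, j, l)) else 0)"

definition frontal_slice :: "nat \<Rightarrow> nat \<Rightarrow> 'k tensor \<Rightarrow> nat \<Rightarrow> 'k mat" where
  "frontal_slice m n A k = mat m n (\<lambda>(i, j). A (i, j, k))"

text \<open>The operands lie in \<open>K\<^sup>m\<^sup>\<times>\<^sup>n\<^sup>\<times>\<^sup>q\<close> and \<open>K\<^sup>n\<^sup>\<times>\<^sup>s\<^sup>\<times>\<^sup>q\<close>. No bound on \<open>k\<close> is needed: slices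
  outside the range of the third index are zero.\<close>

definition facewise_product ::
    "nat \<Rightarrow> nat \<Rightarrow> nat \<Rightarrow> 'k::comm_ring_1 tensor \<Rightarrow> 'k tensor \<Rightarrow> 'k tensor" where
  "facewise_product m n s A B =
     (\<lambda>(i, j, k). if i < m \<and> j < s
        then (frontal_slice m n A k * frontal_slice n s B k) $$ (i, j) else 0)"

text \<open>\<^const>\<open>mat_adjoint\<close> is the conjugate transpose (the transpose over the reals). The inverse
  exists for \<open>M\<close> of full row rank over the real or complex numbers.\<close>

definition moore_penrose :: "'k::conjugatable_field mat \<Rightarrow> 'k mat" where
  "moore_penrose M = mat_adjoint M * the (mat_inverse (M * mat_adjoint M))"

definition tensor_mult ::
    "'k::conjugatable_field mat \<Rightarrow> nat \<Rightarrow> nat \<Rightarrow> nat \<Rightarrow> 'k tensor \<Rightarrow> 'k tensor \<Rightarrow> 'k tensor" where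
  "tensor_mult M m n s A B =
     mode3_product (facewise_product m n s (mode3_product A M) (mode3_product B M))
       (moore_penrose M)"

subsection \<open>Tensor rank\<close>

definition linear_form_on ::
    "('k::field \<Rightarrow> 'u::ab_group_add \<Rightarrow> 'u) \<Rightarrow> 'u set \<Rightarrow> ('u \<Rightarrow> 'k) \<Rightarrow> bool" where
  "linear_form_on scale U f \<longleftrightarrow>
     (\<forall>x\<in>U. \<forall>y\<in>U. f (x + y) = f x + f y) \<and> (\<forall>c. \<forall>x\<in>U. f (scale c x) = c * f x)"

text \<open>\<open>T\<close> is a bilinear map from \<open>U \<times> V\<close> to \<open>W\<close>; the first three arguments are the scalar
  multiplications of these spaces.\<close>

definition tensor_rank ::
    "('k::field \<Rightarrow> 'u::ab_group_add \<Rightarrow> 'u) \<Rightarrow> ('k \<Rightarrow> 'v::ab_group_add \<Rightarrow> 'v) \<Rightarrow>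
     ('k \<Rightarrow> 'w::ab_group_add \<Rightarrow> 'w) \<Rightarrow> 'u set \<Rightarrow> 'v set \<Rightarrow> 'w set \<Rightarrow> ('u \<Rightarrow> 'v \<Rightarrow> 'w) \<Rightarrow> nat" where
  "tensor_rank sU sV sW U V W T =
     (LEAST r. \<exists>\<alpha> \<beta> w.
        (\<forall>i<r. linear_form_on sU U (\<alpha> i) \<and> linear_form_on sV V (\<beta> i) \<and> w i \<in> W) \<and>
        (\<forall>u\<in>U. \<forall>v\<in>V. T u v = (\<Sum>i<r. sW (\<alpha> i u * \<beta> i v) (w i))))"

subsection \<open>Polynomials and rational functions in several variables\<close>

type_synonym ('v, 'k) polynomial = "('v \<Rightarrow>\<^sub>0 nat) \<Rightarrow>\<^sub>0 'k"

type_synonym ('v, 'k) rational_function = "('v, 'k) polynomial fract"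

definition poly_in :: "'v set \<Rightarrow> ('v, 'k::zero) polynomial \<Rightarrow> bool" where
  "poly_in V P \<longleftrightarrow> (\<forall>m\<in>Poly_Mapping.keys P. Poly_Mapping.keys m \<subseteq> V)"

definition eval_poly :: "('v \<Rightarrow> 'k) \<Rightarrow> ('v, 'k::field) polynomial \<Rightarrow> 'k" where
  "eval_poly x P =
     (\<Sum>m\<in>Poly_Mapping.keys P. Poly_Mapping.lookup P m *
        (\<Prod>v\<in>Poly_Mapping.keys m. x v ^ Poly_Mapping.lookup m v))"

definition rat_const :: "'k \<Rightarrow> ('v::linorder, 'k::field) rational_function" where
  "rat_const c = Fraction_Field.Fract (Poly_Mapping.single 0 c) 1"

definition rat_var :: "'v \<Rightarrow> ('v::linorder, 'k::field) rational_function" where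
  "rat_var v = Fraction_Field.Fract (Poly_Mapping.single (Poly_Mapping.single v 1) 1) 1"

text \<open>The element \<open>f\<close> of \<open>K(V)\<close> is the function \<open>g\<close> on \<open>K\<^sup>V\<close>, away from the zeros of a denominator.
  As \<open>P\<close> and \<open>Q\<close> only involve variables from \<open>V\<close>, over an infinite field \<open>Q\<close> does not vanish
  identically on \<^term>\<open>coord_space V\<close>, and \<open>f\<close> is determined by \<open>g\<close>.\<close>

definition represents ::
    "'v set \<Rightarrow> ('v::linorder, 'k::field) rational_function \<Rightarrow> (('v \<Rightarrow> 'k) \<Rightarrow> 'k) \<Rightarrow> bool" where
  "represents V f g \<longleftrightarrow>
     (\<exists>P Q. poly_in V P \<and> poly_in V Q \<and> Q \<noteq> 0 \<and> f = Fraction_Field.Fract P Q \<and>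
        (\<forall>x\<in>coord_space V. eval_poly x Q \<noteq> 0 \<longrightarrow> g x = eval_poly x P / eval_poly x Q))"

subsection \<open>Straight-line programs and total complexity\<close>

datatype arith_op = Add | Sub | Mul | Div

datatype ('v, 'k) operand = Input 'v | Const 'k | Result nat

type_synonym ('v, 'k) instr = "arith_op \<times> ('v, 'k) operand \<times> ('v, 'k) operand"

primrec operand_ok :: "'v set \<Rightarrow> nat \<Rightarrow> ('v, 'k) operand \<Rightarrow> bool" where
  "operand_ok V t (Input v) \<longleftrightarrow> v \<in> V"
| "operand_ok V t (Const c) \<longleftrightarrow> True"
| "operand_ok V t (Result i) \<longleftrightarrow> i < t"

primrec operand_val ::
    "('v::linorder, 'k::field) rational_function list \<Rightarrow> ('v, 'k) operand \<Rightarrow>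
     ('v, 'k) rational_function" where
  "operand_val rs (Input v) = rat_var v"
| "operand_val rs (Const c) = rat_const c"
| "operand_val rs (Result i) = rs ! i"

primrec apply_op :: "arith_op \<Rightarrow> 'f::field \<Rightarrow> 'f \<Rightarrow> 'f" where
  "apply_op Add a b = a + b"
| "apply_op Sub a b = a - b"
| "apply_op Mul a b = a * b"
| "apply_op Div a b = a / b"

text \<open>\<open>slp_results V P rs\<close>: the program \<open>P\<close>, executed in \<open>K(V)\<close> on the variables in \<open>V\<close>, never
  divides by zero and produces the list of results \<open>rs\<close>, one for each instruction. The operands
  of an instruction are inputs, constants and results of earlier instructions.\<close>

inductive slp_results ::
    "'v set \<Rightarrow> ('v::linorder, 'k::field) instr list \<Rightarrow> ('v, 'k) rational_function list \<Rightarrow> bool"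
  for V where
  slp_Nil: "slp_results V [] []"
| slp_snoc: "slp_results V P rs \<Longrightarrow>
     operand_ok V (length rs) a \<Longrightarrow> operand_ok V (length rs) b \<Longrightarrow>
     (c = Div \<longrightarrow> operand_val rs b \<noteq> 0) \<Longrightarrow>
     slp_results V (P @ [(c, a, b)]) (rs @ [apply_op c (operand_val rs a) (operand_val rs b)])"

text \<open>The program computes the coordinates \<open>\<lambda>x. \<phi> x w\<close>, \<open>w \<in> W\<close>, of a rational map \<open>\<phi>\<close> from \<open>K\<^sup>V\<close>
  to \<open>K\<^sup>W\<close>. Every coordinate must occur as a result, or be an input or a constant.\<close>

definition slp_computes ::
    "'v set \<Rightarrow> 'w set \<Rightarrow> ('v::linorder, 'k::field) instr list \<Rightarrow> (('v \<Rightarrow> 'k) \<Rightarrow> 'w \<Rightarrow> 'k) \<Rightarrow> bool" where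
  "slp_computes V W P \<phi> \<longleftrightarrow>
     (\<exists>rs. slp_results V P rs \<and>
        (\<forall>w\<in>W. \<exists>a. operand_ok V (length rs) a \<and>
           represents V (operand_val rs a) (\<lambda>x. \<phi> x w)))"

text \<open>Every instruction costs one, including those with constant operands.\<close>

definition total_complexity ::
    "'v set \<Rightarrow> 'w set \<Rightarrow> (('v::linorder \<Rightarrow> 'k::field) \<Rightarrow> 'w \<Rightarrow> 'k) \<Rightarrow> nat" where
  "total_complexity V W \<phi> = (LEAST r. \<exists>P. length P = r \<and> slp_computes V W P \<phi>)"

subsection \<open>Bilinear maps as maps of the coordinates on the product\<close>

text \<open>Coordinates on \<open>K\<^sup>I \<times> K\<^sup>J\<close>, identified with \<open>K\<^sup>V\<close> for the disjoint union \<open>V\<close> of \<open>I\<close> and \<open>J\<close>.\<close>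

datatype ('i, 'j) pair_coord = Fst_Coord 'i | Snd_Coord 'j

instance pair_coord :: (countable, countable) countable
  by countable_datatype

text \<open>The order plays no role in the mathematics: a linear order on the variables is only what
  \<^theory>\<open>HOL-Library.Poly_Mapping\<close> asks for to make polynomials an integral domain.\<close>

instantiation pair_coord :: (countable, countable) linorder
begin

definition less_eq_pair_coord :: "('a, 'b) pair_coord \<Rightarrow> ('a, 'b) pair_coord \<Rightarrow> bool" where
  "less_eq_pair_coord v w \<longleftrightarrow> to_nat v \<le> to_nat w"

definition less_pair_coord :: "('a, 'b) pair_coord \<Rightarrow> ('a, 'b) pair_coord \<Rightarrow> bool" where
  "less_pair_coord v w \<longleftrightarrow> to_nat v < to_nat w"

instance
  by standard (auto simp: less_eq_pair_coord_def less_pair_coord_def)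

end

definition pair_coords :: "'i set \<Rightarrow> 'j set \<Rightarrow> ('i, 'j) pair_coord set" where
  "pair_coords I J = Fst_Coord ` I \<union> Snd_Coord ` J"

definition map_on_pair ::
    "(('i \<Rightarrow> 'k) \<Rightarrow> ('j \<Rightarrow> 'k) \<Rightarrow> 'l \<Rightarrow> 'k) \<Rightarrow> (('i, 'j) pair_coord \<Rightarrow> 'k) \<Rightarrow> 'l \<Rightarrow> 'k" where
  "map_on_pair T x = T (\<lambda>i. x (Fst_Coord i)) (\<lambda>j. x (Snd_Coord j))"

subsection \<open>Asymptotic exponents\<close>

definition growth_exponent :: "(nat \<Rightarrow> nat) \<Rightarrow> ereal" where
  "growth_exponent f =
     Inf {ereal \<tau> | \<tau>. (\<lambda>n. real (f n)) \<in> O(\<lambda>n. real n powr \<tau>)}"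

text \<open>The exponents of a sequence of bilinear maps \<open>T n\<close> from \<open>K\<^sup>I \<times> K\<^sup>J\<close> to \<open>K\<^sup>L\<close>, where \<open>I\<close>, \<open>J\<close>, \<open>L\<close>
  depend on \<open>n\<close>.\<close>

definition rank_exponent ::
    "(nat \<Rightarrow> 'i set) \<Rightarrow> (nat \<Rightarrow> 'j set) \<Rightarrow> (nat \<Rightarrow> 'l set) \<Rightarrow>
     (nat \<Rightarrow> ('i \<Rightarrow> 'k::field) \<Rightarrow> ('j \<Rightarrow> 'k) \<Rightarrow> 'l \<Rightarrow> 'k) \<Rightarrow> ereal" where
  "rank_exponent I J L T =
     growth_exponent (\<lambda>n. tensor_rank coord_scale coord_scale coord_scale
       (coord_space (I n)) (coord_space (J n)) (coord_space (L n)) (T n))"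

definition complexity_exponent ::
    "(nat \<Rightarrow> 'i::countable set) \<Rightarrow> (nat \<Rightarrow> 'j::countable set) \<Rightarrow> (nat \<Rightarrow> 'l set) \<Rightarrow>
     (nat \<Rightarrow> ('i \<Rightarrow> 'k::field) \<Rightarrow> ('j \<Rightarrow> 'k) \<Rightarrow> 'l \<Rightarrow> 'k) \<Rightarrow> ereal" where
  "complexity_exponent I J L T =
     growth_exponent (\<lambda>n. total_complexity (pair_coords (I n) (J n)) (L n) (map_on_pair (T n)))"

subsection \<open>Tensor-tensor multiplication of square format\<close>

definition TM_index :: "nat \<Rightarrow> nat \<Rightarrow> (nat \<times> nat \<times> nat) set" where
  "TM_index p n = tensor_index n n p"

definition TM :: "'k::conjugatable_field mat \<Rightarrow> nat \<Rightarrow> 'k tensor \<Rightarrow> 'k tensor \<Rightarrow> 'k tensor" where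
  "TM M n = tensor_mult M n n n"

end

theory Submission
  imports Defs "HOL-Computational_Algebra.Polynomial_FPS" "HOL-Real_Asymp.Real_Asymp"
begin

text \<open>Rank is at most twice the complexity, by Strassen's argument: expand all results of a
  straight-line program along lines through a point where no denominator vanishes. The quadratic
  coefficients of the results lie in the span of one product of two linear forms per instruction,
  and the quadratic coefficient of a bilinear map is the map itself; polarization gives a bilinear
  decomposition.

  Conversely, \<open>n \<times> n\<close> matrix multiplication is a restriction of \<open>TM M n\<close>, since \<open>M\<close> has a right
  inverse, so its rank is at most \<open>R n\<close>, the rank of \<open>TM M n\<close>; and it is at least \<open>n\<^sup>2\<close>. Recursion
  on blocks with a decomposition for one fixed large \<open>m\<close> costs \<open>O(\<rho>\<^sup>k)\<close> at size \<open>m\<^sup>k\<close>, where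
  \<open>\<rho> = max (R m) (m\<^sup>2 + 1)\<close>, and \<open>\<rho> \<le> m powr (\<tau> + \<epsilon>)\<close> if \<open>R n\<close> is \<open>O(n powr \<tau>)\<close>. Finally \<open>TM M n\<close>
  consists of \<open>q\<close> matrix products and \<open>O(n\<^sup>2)\<close> further operations.\<close>

subsection \<open>Substitution into polynomials\<close>

text \<open>Divisions rule out an expansion at the origin: the base point has to avoid the zeros of
  every divisor. This costs nothing, because the t^2-coefficient of T (x + t u) (y + t v) is T u v
  at every base point (x, y). The factor two is the price of polarization: a product l * m of linear
  forms in the pair (u, v) contributes both l(u) m(v) and m(u) l(v). In the converse direction, a
  constant C hidden in O(n powr \<tau>) would be raised to the recursion depth, which grows like log
  n. So m is fixed with m powr \<epsilon> at least C before the recursion starts, and \<epsilon>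
  disappears in the infimum. The summand 1 in \<rho> makes the linear operations on all levels sum
  to O(\<rho>^k), even if the rank equals m^2. The bound n^2 on the rank forces \<tau> to be at
  least 2, so quadratic costs are absorbed.\<close>

definition monomial_val :: "('v \<Rightarrow> 'b) \<Rightarrow> ('v \<Rightarrow>\<^sub>0 nat) \<Rightarrow> 'b::comm_ring_1" where
  "monomial_val y m = (\<Prod>v\<in>Poly_Mapping.keys m. y v ^ Poly_Mapping.lookup m v)"

text \<open>The homomorphism \<open>\<phi>\<close> covers two uses at once: with \<open>id\<close>
  this is evaluation at a point; with constants embedded in K[t] and the variable v sent to x v + t
  * h v it is restriction to a line.\<close>

definition poly_subst ::
    "('k::comm_ring_1 \<Rightarrow> 'b::comm_ring_1) \<Rightarrow> ('v \<Rightarrow> 'b) \<Rightarrow> ('v, 'k) polynomial \<Rightarrow> 'b" where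
  "poly_subst \<phi> y P =
     (\<Sum>m\<in>Poly_Mapping.keys P. \<phi> (Poly_Mapping.lookup P m) * monomial_val y m)"

lemma eval_poly_eq_poly_subst: "eval_poly x P = poly_subst id x P"
  by (simp add: eval_poly_def poly_subst_def monomial_val_def)

lemma monomial_val_superset:
  assumes "finite S" "Poly_Mapping.keys m \<subseteq> S"
  shows "monomial_val y m = (\<Prod>v\<in>S. y v ^ Poly_Mapping.lookup m v)"
  unfolding monomial_val_def
  using assms by (intro prod.mono_neutral_left) (auto simp: in_keys_iff)

lemma monomial_val_0 [simp]: "monomial_val y 0 = 1"
  by (simp add: monomial_val_def)

lemma monomial_val_single [simp]: "monomial_val y (Poly_Mapping.single v k) = y v ^ k"
  by (simp add: monomial_val_def)

lemma monomial_val_add: "monomial_val y (m + n) = monomial_val y m * monomial_val y n"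
proof -
  let ?S = "Poly_Mapping.keys m \<union> Poly_Mapping.keys n"
  have "monomial_val y (m + n) = (\<Prod>v\<in>?S. y v ^ Poly_Mapping.lookup (m + n) v)"
    by (rule monomial_val_superset) (use keys_add[of m n] in auto)
  also have "\<dots> = (\<Prod>v\<in>?S. y v ^ Poly_Mapping.lookup m v) * (\<Prod>v\<in>?S. y v ^ Poly_Mapping.lookup n v)"
    by (simp add: lookup_add power_add prod.distrib)
  also have "\<dots> = monomial_val y m * monomial_val y n"
    by (simp add: monomial_val_superset[of ?S])
  finally show ?thesis .
qed

lemma monomial_val_mult: "monomial_val (\<lambda>v. x v * y v) m = monomial_val x m * monomial_val y m"
  by (simp add: monomial_val_def power_mult_distrib prod.distrib)

lemma poly_mapping_sum_single:
  "(\<Sum>m\<in>Poly_Mapping.keys P. Poly_Mapping.single m (Poly_Mapping.lookup P m)) = P"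
  by (rule poly_mapping_eqI) (auto simp: lookup_sum lookup_single when_def in_keys_iff)

context
  fixes \<phi> :: "'k::comm_ring_1 \<Rightarrow> 'b::comm_ring_1"
  assumes hom: "comm_ring_hom \<phi>"
begin

interpretation comm_ring_hom \<phi> by (rule hom)

lemma poly_subst_superset:
  assumes "finite S" "Poly_Mapping.keys P \<subseteq> S"
  shows "poly_subst \<phi> y P = (\<Sum>m\<in>S. \<phi> (Poly_Mapping.lookup P m) * monomial_val y m)"
  unfolding poly_subst_def
  using assms by (intro sum.mono_neutral_left) (auto simp: in_keys_iff)

lemma poly_subst_0 [simp]: "poly_subst \<phi> y 0 = 0"
  by (simp add: poly_subst_def)

lemma poly_subst_add: "poly_subst \<phi> y (P + Q) = poly_subst \<phi> y P + poly_subst \<phi> y Q"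
proof -
  let ?S = "Poly_Mapping.keys P \<union> Poly_Mapping.keys Q"
  have "poly_subst \<phi> y (P + Q)
      = (\<Sum>m\<in>?S. \<phi> (Poly_Mapping.lookup (P + Q) m) * monomial_val y m)"
    by (rule poly_subst_superset) (use keys_add[of P Q] in auto)
  also have "\<dots> = poly_subst \<phi> y P + poly_subst \<phi> y Q"
    by (simp add: poly_subst_superset[of ?S] lookup_add hom_add algebra_simps sum.distrib)
  finally show ?thesis .
qed

lemma poly_subst_sum: "poly_subst \<phi> y (sum f S) = (\<Sum>i\<in>S. poly_subst \<phi> y (f i))"
  by (induction S rule: infinite_finite_induct) (simp_all add: poly_subst_add)

lemma poly_subst_single: "poly_subst \<phi> y (Poly_Mapping.single m c) = \<phi> c * monomial_val y m"
  by (simp add: poly_subst_def)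

lemma poly_subst_mult: "poly_subst \<phi> y (P * Q) = poly_subst \<phi> y P * poly_subst \<phi> y Q"
proof -
  have "P * Q = (\<Sum>m\<in>Poly_Mapping.keys P. \<Sum>n\<in>Poly_Mapping.keys Q.
      Poly_Mapping.single (m + n) (Poly_Mapping.lookup P m * Poly_Mapping.lookup Q n))"
    by (subst poly_mapping_sum_single[of P, symmetric],
        subst poly_mapping_sum_single[of Q, symmetric]) (simp add: sum_product mult_single)
  then have "poly_subst \<phi> y (P * Q) = (\<Sum>m\<in>Poly_Mapping.keys P. \<Sum>n\<in>Poly_Mapping.keys Q.
      (\<phi> (Poly_Mapping.lookup P m) * monomial_val y m) *
      (\<phi> (Poly_Mapping.lookup Q n) * monomial_val y n))"
    by (simp add: poly_subst_sum poly_subst_single monomial_val_add hom_mult mult_ac)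
  then show ?thesis
    by (simp add: poly_subst_def sum_product)
qed

end

lemma comm_ring_hom_id: "comm_ring_hom id"
  by standard auto

lemma eval_poly_add: "eval_poly x (P + Q) = eval_poly x P + eval_poly x Q"
  unfolding eval_poly_eq_poly_subst by (rule poly_subst_add[OF comm_ring_hom_id])

lemma eval_poly_mult: "eval_poly x (P * Q) = eval_poly x P * eval_poly x Q"
  unfolding eval_poly_eq_poly_subst by (rule poly_subst_mult[OF comm_ring_hom_id])

lemma eval_poly_single: "eval_poly x (Poly_Mapping.single m c) = c * monomial_val x m"
  by (simp add: eval_poly_eq_poly_subst poly_subst_single[OF comm_ring_hom_id])

lemma eval_poly_1 [simp]: "eval_poly x 1 = 1"
  using eval_poly_single[of x 0 1] by simp

lemma eval_poly_cong:
  assumes "poly_in V P" "\<And>v. v \<in> V \<Longrightarrow> x v = y v"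
  shows "eval_poly x P = eval_poly y P"
proof -
  have "x v = y v" if "m \<in> Poly_Mapping.keys P" "v \<in> Poly_Mapping.keys m" for m v
    using assms that unfolding poly_in_def by blast
  then show ?thesis unfolding eval_poly_def by simp
qed

text \<open>Distinct monomials are distinct multiplicative characters, and the argument is the one for
  the linear independence of characters.\<close>

lemma monomials_independent:
  fixes c :: "('v \<Rightarrow>\<^sub>0 nat) \<Rightarrow> 'k::field_char_0"
  assumes "finite A" "\<And>x. (\<Sum>m\<in>A. c m * monomial_val x m) = 0"
  shows "\<forall>m\<in>A. c m = 0"
  using assms
proof (induction A arbitrary: c rule: finite_induct)
  case (insert a A)
  have "c m = 0" if m: "m \<in> A" for m
  proof -
    have "m \<noteq> a" using m insert.hyps by auto
    then obtain v where v: "Poly_Mapping.lookup m v \<noteq> Poly_Mapping.lookup a v"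
      by (metis poly_mapping_eqI)
    \<comment> \<open>Monomials take the value 2 ^ (exponent of v) here, so m and a are separated,
      powers of 2 being distinct in characteristic 0. Rescaling x by y and subtracting
      \<open>monomial_val y a\<close> times the original relation removes the term of a.\<close>
    define y :: "'v \<Rightarrow> 'k" where "y = (\<lambda>u. if u = v then 2 else 1)"
    have y: "monomial_val y n = 2 ^ Poly_Mapping.lookup n v" for n
    proof -
      have "monomial_val y n
          = (\<Prod>u\<in>insert v (Poly_Mapping.keys n). y u ^ Poly_Mapping.lookup n u)"
        by (rule monomial_val_superset) auto
      also have "\<dots> = (\<Prod>u\<in>insert v (Poly_Mapping.keys n).
          if u = v then 2 ^ Poly_Mapping.lookup n v else 1)"
        by (rule prod.cong) (auto simp: y_def)
      also have "\<dots> = 2 ^ Poly_Mapping.lookup n v"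
        by (subst prod.delta) auto
      finally show ?thesis .
    qed
    have "\<forall>n\<in>A. c n * (monomial_val y n - monomial_val y a) = 0"
    proof (rule insert.IH)
      fix x
      have "(\<Sum>n\<in>insert a A. c n * monomial_val (\<lambda>u. y u * x u) n) = 0"
        "(\<Sum>n\<in>insert a A. c n * monomial_val x n) = 0"
        by (rule insert.prems)+
      then have "(\<Sum>n\<in>insert a A. c n * monomial_val (\<lambda>u. y u * x u) n)
          - monomial_val y a * (\<Sum>n\<in>insert a A. c n * monomial_val x n) = 0"
        by simp
      then show "(\<Sum>n\<in>A. c n * (monomial_val y n - monomial_val y a) * monomial_val x n) = 0"
        using insert.hyps
        by (simp add: monomial_val_mult algebra_simps sum_distrib_left sum_subtractf)
    qed
    moreover have "(2::'k) ^ i = 2 ^ j \<longleftrightarrow> i = j" for i j :: nat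
    proof -
      have "(2::'k) ^ i = 2 ^ j \<longleftrightarrow> of_nat (2 ^ i) = (of_nat (2 ^ j) :: 'k)" by simp
      also have "\<dots> \<longleftrightarrow> i = j" unfolding of_nat_eq_iff by simp
      finally show ?thesis .
    qed
    ultimately show ?thesis using m v by (auto simp: y)
  qed
  moreover have "c a = 0"
  proof -
    have "(\<Sum>m\<in>insert a A. c m * monomial_val (\<lambda>_. 1) m) = 0" by (rule insert.prems)
    with calculation insert.hyps show ?thesis by (simp add: monomial_val_def)
  qed
  ultimately show ?case by auto
qed auto

lemma poly_nonzero_value:
  fixes P :: "('v, 'k::field_char_0) polynomial"
  assumes "P \<noteq> 0"
  obtains x where "eval_poly x P \<noteq> 0"
proof -
  have "\<exists>x. eval_poly x P \<noteq> 0"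
  proof (rule ccontr)
    assume "\<nexists>x. eval_poly x P \<noteq> 0"
    then have "\<forall>m\<in>Poly_Mapping.keys P. Poly_Mapping.lookup P m = 0"
      by (intro monomials_independent) (auto simp: eval_poly_def monomial_val_def)
    then have "P = 0" by (intro poly_mapping_eqI) (auto simp: in_keys_iff)
    with assms show False ..
  qed
  with that show thesis by blast
qed

section \<open>Rank bounded by complexity: power series expansions of programs\<close>

subsection \<open>Restriction to a line\<close>

definition line_poly :: "('v \<Rightarrow> 'k) \<Rightarrow> ('v \<Rightarrow> 'k) \<Rightarrow> ('v, 'k::field) polynomial \<Rightarrow> 'k poly" where
  "line_poly x h = poly_subst (\<lambda>c. [:c:]) (\<lambda>v. [:x v, h v:])"

lemma comm_ring_hom_const_poly: "comm_ring_hom (\<lambda>c::'k::comm_ring_1. [:c:])"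
  by standard auto

lemma line_poly_add: "line_poly x h (P + Q) = line_poly x h P + line_poly x h Q"
  unfolding line_poly_def by (rule poly_subst_add[OF comm_ring_hom_const_poly])

lemma line_poly_mult: "line_poly x h (P * Q) = line_poly x h P * line_poly x h Q"
  unfolding line_poly_def by (rule poly_subst_mult[OF comm_ring_hom_const_poly])

lemma line_poly_single:
  "line_poly x h (Poly_Mapping.single m c) = [:c:] * monomial_val (\<lambda>v. [:x v, h v:]) m"
  unfolding line_poly_def by (rule poly_subst_single[OF comm_ring_hom_const_poly])

lemma line_poly_1 [simp]: "line_poly x h 1 = 1"
  using line_poly_single[of x h 0 1] by (simp flip: single_one)

lemma line_poly_uminus: "line_poly x h (- P) = - line_poly x h P"
proof -
  have "line_poly x h (- P + P) = line_poly x h (- P) + line_poly x h P"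
    by (rule line_poly_add)
  then show ?thesis by (simp add: line_poly_def poly_subst_def eq_neg_iff_add_eq_0)
qed

lemma poly_line_poly: "poly (line_poly x h P) t = eval_poly (\<lambda>v. x v + t * h v) P"
  by (simp add: line_poly_def poly_subst_def eval_poly_def monomial_val_def poly_sum poly_prod)

lemma coeff_line_poly_0: "coeff (line_poly x h P) 0 = eval_poly x P"
  using poly_line_poly[of x h P 0] by (simp add: poly_0_coeff_0)

subsection \<open>Jets of rational functions\<close>

text \<open>\<open>F\<close> is the expansion of \<open>f (x + t h)\<close> in powers of \<open>t\<close>.\<close>

definition has_jet ::
    "('v \<Rightarrow> 'k) \<Rightarrow> ('v \<Rightarrow> 'k) \<Rightarrow> ('v::linorder, 'k::field) rational_function \<Rightarrow> 'k fps \<Rightarrow> bool" where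
  "has_jet x h f F \<longleftrightarrow>
     (\<exists>P Q. eval_poly x Q \<noteq> 0 \<and> f = Fraction_Field.Fract P Q \<and>
        F * fps_of_poly (line_poly x h Q) = fps_of_poly (line_poly x h P))"

lemma eval_poly_nonzeroD: "eval_poly x Q \<noteq> 0 \<Longrightarrow> Q \<noteq> 0"
  by (auto simp: eval_poly_def)

lemma fps_line_poly_nonzero: "eval_poly x Q \<noteq> 0 \<Longrightarrow> fps_of_poly (line_poly x h Q) \<noteq> 0"
  using coeff_line_poly_0[of x h Q] by auto

text \<open>Cross-multiplication transfers the defining equation from the representation chosen in
  \<open>has_jet\<close> to any other one, even if its denominator vanishes at x, since power series
  over a field form an integral domain.\<close>

lemma has_jet_Fract:
  assumes "has_jet x h (Fraction_Field.Fract N D) F" "D \<noteq> 0"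
  shows "F * fps_of_poly (line_poly x h D) = fps_of_poly (line_poly x h N)"
proof -
  obtain P Q where Q: "eval_poly x Q \<noteq> 0"
    and eq: "Fraction_Field.Fract N D = Fraction_Field.Fract P Q"
    and F: "F * fps_of_poly (line_poly x h Q) = fps_of_poly (line_poly x h P)"
    using assms(1) unfolding has_jet_def by blast
  have "N * Q = P * D"
    using eq assms(2) eval_poly_nonzeroD[OF Q] by (simp add: eq_fract)
  then have "line_poly x h N * line_poly x h Q = line_poly x h P * line_poly x h D"
    by (metis line_poly_mult)
  then have "fps_of_poly (line_poly x h N) * fps_of_poly (line_poly x h Q)
      = fps_of_poly (line_poly x h P) * fps_of_poly (line_poly x h D)"
    by (simp flip: fps_of_poly_mult)
  then have "F * fps_of_poly (line_poly x h D) * fps_of_poly (line_poly x h Q)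
      = fps_of_poly (line_poly x h N) * fps_of_poly (line_poly x h Q)"
    unfolding F[symmetric] by (simp only: mult_ac)
  then show ?thesis using fps_line_poly_nonzero[OF Q] by simp
qed

lemma has_jet_const: "has_jet x h (rat_const c) (fps_const c)"
  unfolding has_jet_def rat_const_def
  by (intro exI[of _ "Poly_Mapping.single 0 c"] exI[of _ 1])
    (simp add: line_poly_single fps_of_poly_const)

lemma has_jet_var: "has_jet x h (rat_var v) (fps_const (x v) + fps_const (h v) * fps_X)"
  unfolding has_jet_def rat_var_def
  by (intro exI[of _ "Poly_Mapping.single (Poly_Mapping.single v 1) 1"] exI[of _ 1])
    (simp add: line_poly_single fps_of_poly_pCons one_pCons[symmetric])

lemma has_jet_add:
  assumes "has_jet x h f F" "has_jet x h g G"
  shows "has_jet x h (f + g) (F + G)"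
proof -
  obtain P Q P' Q' where Q: "eval_poly x Q \<noteq> 0" "f = Fraction_Field.Fract P Q"
      "F * fps_of_poly (line_poly x h Q) = fps_of_poly (line_poly x h P)"
    and Q': "eval_poly x Q' \<noteq> 0" "g = Fraction_Field.Fract P' Q'"
      "G * fps_of_poly (line_poly x h Q') = fps_of_poly (line_poly x h P')"
    using assms unfolding has_jet_def by blast
  show ?thesis unfolding has_jet_def
    by (rule exI[of _ "P * Q' + P' * Q"], rule exI[of _ "Q * Q'"])
      (simp add: Q(1,2) Q'(1,2) eval_poly_mult eval_poly_nonzeroD[OF Q(1)]
        eval_poly_nonzeroD[OF Q'(1)] line_poly_add line_poly_mult fps_of_poly_mult
        fps_of_poly_add algebra_simps flip: Q(3) Q'(3))
qed

lemma has_jet_uminus: "has_jet x h f F \<Longrightarrow> has_jet x h (- f) (- F)"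
  unfolding has_jet_def by (metis fps_of_poly_uminus line_poly_uminus minus_fract minus_mult_left)

lemma has_jet_diff: "has_jet x h f F \<Longrightarrow> has_jet x h g G \<Longrightarrow> has_jet x h (f - g) (F - G)"
  using has_jet_add[of x h f F "- g" "- G"] has_jet_uminus[of x h g G] by simp

lemma has_jet_mult:
  assumes "has_jet x h f F" "has_jet x h g G"
  shows "has_jet x h (f * g) (F * G)"
proof -
  obtain P Q P' Q' where Q: "eval_poly x Q \<noteq> 0" "f = Fraction_Field.Fract P Q"
      "F * fps_of_poly (line_poly x h Q) = fps_of_poly (line_poly x h P)"
    and Q': "eval_poly x Q' \<noteq> 0" "g = Fraction_Field.Fract P' Q'"
      "G * fps_of_poly (line_poly x h Q') = fps_of_poly (line_poly x h P')"
    using assms unfolding has_jet_def by blast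
  show ?thesis unfolding has_jet_def
    by (rule exI[of _ "P * P'"], rule exI[of _ "Q * Q'"])
      (simp add: Q(1,2) Q'(1,2) eval_poly_mult line_poly_mult fps_of_poly_mult
        mult_ac flip: Q(3) Q'(3))
qed

lemma has_jet_divide:
  assumes "has_jet x h f F" "has_jet x h g G" "fps_nth G 0 \<noteq> 0"
  shows "has_jet x h (f / g) (F * inverse G)"
proof -
  obtain P Q P' Q' where Q: "eval_poly x Q \<noteq> 0" "f = Fraction_Field.Fract P Q"
      "F * fps_of_poly (line_poly x h Q) = fps_of_poly (line_poly x h P)"
    and Q': "eval_poly x Q' \<noteq> 0" "g = Fraction_Field.Fract P' Q'"
      "G * fps_of_poly (line_poly x h Q') = fps_of_poly (line_poly x h P')"
    using assms(1,2) unfolding has_jet_def by blast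
  \<comment> \<open>P' enters the denominator of f / g, so it must not vanish at x; this equation
    reduces that to the constant term of G.\<close>
  have "eval_poly x P' = fps_nth G 0 * eval_poly x Q'"
    using arg_cong[OF Q'(3), of "\<lambda>F. fps_nth F 0"] by (simp add: coeff_line_poly_0)
  moreover have "F * inverse G * fps_of_poly (line_poly x h (Q * P'))
      = fps_of_poly (line_poly x h (P * Q'))"
  proof -
    have "F * inverse G * (fps_of_poly (line_poly x h Q) * (G * fps_of_poly (line_poly x h Q')))
        = (inverse G * G) * (F * fps_of_poly (line_poly x h Q)) * fps_of_poly (line_poly x h Q')"
      by (simp only: mult_ac)
    then show ?thesis
      by (simp add: line_poly_mult fps_of_poly_mult Q(3) Q'(3) inverse_mult_eq_1[OF assms(3)])
  qed
  ultimately show ?thesis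
    using assms(3) Q Q'
    unfolding has_jet_def by (intro exI[of _ "P * Q'"] exI[of _ "Q * P'"]) (simp add: eval_poly_mult)
qed

subsection \<open>Quadratic parts of the results of a program\<close>

abbreviation linear_form :: "(('v \<Rightarrow> 'k::field) \<Rightarrow> 'k) \<Rightarrow> bool" where
  "linear_form \<equiv> linear_form_on coord_scale UNIV"

text \<open>The base point is fixed and h is the direction. The forms l and m are shared by all
  results of a program, while \<gamma> belongs to the single family F. Coefficients beyond order 2
  never influence those of order at most 2, so nothing is recorded about them.\<close>

definition quadratic_jets ::
    "nat \<Rightarrow> (nat \<Rightarrow> ('v \<Rightarrow> 'k) \<Rightarrow> 'k) \<Rightarrow> (nat \<Rightarrow> ('v \<Rightarrow> 'k) \<Rightarrow> 'k::field) \<Rightarrow>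
     (('v \<Rightarrow> 'k) \<Rightarrow> 'k fps) set" where
  "quadratic_jets r l m =
     {F. (\<exists>c. \<forall>h. fps_nth (F h) 0 = c) \<and> linear_form (\<lambda>h. fps_nth (F h) 1) \<and>
         (\<exists>\<gamma>. \<forall>h. fps_nth (F h) 2 = (\<Sum>j<r. \<gamma> j * (l j h * m j h)))}"

lemma quadratic_jetsI:
  assumes "\<And>h. fps_nth (F h) 0 = c" "linear_form (\<lambda>h. fps_nth (F h) 1)"
    "\<And>h. fps_nth (F h) 2 = (\<Sum>j<r. \<gamma> j * (l j h * m j h))"
  shows "F \<in> quadratic_jets r l m"
  unfolding quadratic_jets_def
  by (rule CollectI, intro conjI exI allI) (rule assms)+

lemma quadratic_jetsE:
  assumes "F \<in> quadratic_jets r l m"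
  obtains c \<gamma> where "\<And>h. fps_nth (F h) 0 = c" "linear_form (\<lambda>h. fps_nth (F h) 1)"
    "\<And>h. fps_nth (F h) 2 = (\<Sum>j<r. \<gamma> j * (l j h * m j h))"
  using assms unfolding quadratic_jets_def mem_Collect_eq by blast

lemma quadratic_jets_const: "(\<lambda>h. fps_const c) \<in> quadratic_jets r l m"
  by (rule quadratic_jetsI[where \<gamma> = "\<lambda>_. 0"]) (simp_all add: linear_form_on_def)

lemma quadratic_jets_var:
  "(\<lambda>h. fps_const a + fps_const (h v) * fps_X) \<in> quadratic_jets r l m"
  by (rule quadratic_jetsI[where \<gamma> = "\<lambda>_. 0"]) (simp_all add: linear_form_on_def coord_scale_def)

lemma quadratic_jets_add:
  assumes "A \<in> quadratic_jets r l m" "B \<in> quadratic_jets r l m"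
  shows "(\<lambda>h. A h + B h) \<in> quadratic_jets r l m"
proof -
  obtain a \<gamma> where A: "\<And>h. fps_nth (A h) 0 = a" "linear_form (\<lambda>h. fps_nth (A h) 1)"
      "\<And>h. fps_nth (A h) 2 = (\<Sum>j<r. \<gamma> j * (l j h * m j h))"
    using assms(1) by (rule quadratic_jetsE) (rule that)
  obtain b \<delta> where B: "\<And>h. fps_nth (B h) 0 = b" "linear_form (\<lambda>h. fps_nth (B h) 1)"
      "\<And>h. fps_nth (B h) 2 = (\<Sum>j<r. \<delta> j * (l j h * m j h))"
    using assms(2) by (rule quadratic_jetsE) (rule that)
  show ?thesis
  proof (rule quadratic_jetsI[where c = "a + b" and \<gamma> = "\<lambda>j. \<gamma> j + \<delta> j"])
    show "linear_form (\<lambda>h. fps_nth (A h + B h) 1)"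
      using A(2) B(2) by (simp add: linear_form_on_def algebra_simps)
  qed (simp_all add: A(1,3) B(1,3) algebra_simps sum.distrib)
qed

lemma quadratic_jets_diff:
  assumes "A \<in> quadratic_jets r l m" "B \<in> quadratic_jets r l m"
  shows "(\<lambda>h. A h - B h) \<in> quadratic_jets r l m"
proof -
  obtain a \<gamma> where A: "\<And>h. fps_nth (A h) 0 = a" "linear_form (\<lambda>h. fps_nth (A h) 1)"
      "\<And>h. fps_nth (A h) 2 = (\<Sum>j<r. \<gamma> j * (l j h * m j h))"
    using assms(1) by (rule quadratic_jetsE) (rule that)
  obtain b \<delta> where B: "\<And>h. fps_nth (B h) 0 = b" "linear_form (\<lambda>h. fps_nth (B h) 1)"
      "\<And>h. fps_nth (B h) 2 = (\<Sum>j<r. \<delta> j * (l j h * m j h))"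
    using assms(2) by (rule quadratic_jetsE) (rule that)
  show ?thesis
  proof (rule quadratic_jetsI[where c = "a - b" and \<gamma> = "\<lambda>j. \<gamma> j - \<delta> j"])
    show "linear_form (\<lambda>h. fps_nth (A h - B h) 1)"
      using A(2) B(2) by (simp add: linear_form_on_def algebra_simps)
  qed (simp_all add: A(1,3) B(1,3) algebra_simps sum_subtractf)
qed

text \<open>Additions and subtractions create no product, but they reserve a slot with coefficient
  0, so that the number of products always equals the number of instructions.\<close>

lemma quadratic_jets_Suc:
  assumes "A \<in> quadratic_jets r l m"
  shows "A \<in> quadratic_jets (Suc r) (l(r := l')) (m(r := m'))"
proof -
  obtain a \<gamma> where A: "\<And>h. fps_nth (A h) 0 = a" "linear_form (\<lambda>h. fps_nth (A h) 1)"
      "\<And>h. fps_nth (A h) 2 = (\<Sum>j<r. \<gamma> j * (l j h * m j h))"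
    using assms(1) by (rule quadratic_jetsE) (rule that)
  show ?thesis
    by (rule quadratic_jetsI[where \<gamma> = "\<gamma>(r := 0)", OF A(1,2)]) (simp add: A(3))
qed

text \<open>In the t^2-coefficient a B_2 + A_1 B_1 + b A_2 the constants a and b do not depend on h,
  so A_1 B_1 is the only term outside the old span.\<close>

lemma quadratic_jets_mult:
  assumes "A \<in> quadratic_jets r l m" "B \<in> quadratic_jets r l m"
  shows "(\<lambda>h. A h * B h) \<in>
    quadratic_jets (Suc r) (l(r := \<lambda>h. fps_nth (A h) 1)) (m(r := \<lambda>h. fps_nth (B h) 1))"
proof -
  obtain a \<gamma> where A: "\<And>h. fps_nth (A h) 0 = a" "linear_form (\<lambda>h. fps_nth (A h) 1)"
      "\<And>h. fps_nth (A h) 2 = (\<Sum>j<r. \<gamma> j * (l j h * m j h))"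
    using assms(1) by (rule quadratic_jetsE) (rule that)
  obtain b \<delta> where B: "\<And>h. fps_nth (B h) 0 = b" "linear_form (\<lambda>h. fps_nth (B h) 1)"
      "\<And>h. fps_nth (B h) 2 = (\<Sum>j<r. \<delta> j * (l j h * m j h))"
    using assms(2) by (rule quadratic_jetsE) (rule that)
  have 1: "fps_nth (A h * B h) 1 = a * fps_nth (B h) 1 + b * fps_nth (A h) 1" for h
    by (simp add: fps_mult_nth A(1) B(1))
  have 2: "fps_nth (A h * B h) 2
      = a * fps_nth (B h) 2 + fps_nth (A h) 1 * fps_nth (B h) 1 + b * fps_nth (A h) 2" for h
    using A(1)[of h] B(1)[of h] by (simp add: fps_mult_nth numeral_2_eq_2 algebra_simps)
  show ?thesis
  proof (rule quadratic_jetsI[where c = "a * b" and \<gamma> = "(\<lambda>j. a * \<delta> j + b * \<gamma> j)(r := 1)"])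
    show "linear_form (\<lambda>h. fps_nth (A h * B h) 1)"
      unfolding 1 using A(2) B(2) by (simp add: linear_form_on_def algebra_simps)
    show "fps_nth (A h * B h) 0 = a * b" for h by (simp add: A(1) B(1))
    fix h
    show "fps_nth (A h * B h) 2 = (\<Sum>j<Suc r. ((\<lambda>j. a * \<delta> j + b * \<gamma> j)(r := 1)) j *
        ((l(r := \<lambda>h. fps_nth (A h) 1)) j h * (m(r := \<lambda>h. fps_nth (B h) 1)) j h))"
      unfolding 2 A(3) B(3) by (simp add: algebra_simps sum.distrib sum_distrib_left)
  qed
qed

text \<open>Division is a multiplication read backwards, so it also contributes a single product.\<close>

lemma quadratic_jets_divide:
  assumes "A \<in> quadratic_jets r l m" "B \<in> quadratic_jets r l m"
    and b0: "\<And>h. fps_nth (B h) 0 \<noteq> 0"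
  defines "C \<equiv> \<lambda>h. A h * inverse (B h)"
  shows "C \<in> quadratic_jets (Suc r) (l(r := \<lambda>h. fps_nth (C h) 1)) (m(r := \<lambda>h. fps_nth (B h) 1))"
proof -
  obtain a \<gamma> where A: "\<And>h. fps_nth (A h) 0 = a" "linear_form (\<lambda>h. fps_nth (A h) 1)"
      "\<And>h. fps_nth (A h) 2 = (\<Sum>j<r. \<gamma> j * (l j h * m j h))"
    using assms(1) by (rule quadratic_jetsE) (rule that)
  obtain b \<delta> where B: "\<And>h. fps_nth (B h) 0 = b" "linear_form (\<lambda>h. fps_nth (B h) 1)"
      "\<And>h. fps_nth (B h) 2 = (\<Sum>j<r. \<delta> j * (l j h * m j h))"
    using assms(2) by (rule quadratic_jetsE) (rule that)
  have b: "b \<noteq> 0" using b0 B(1) by simp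
  \<comment> \<open>Comparing coefficients in A = C B and solving for C order by order; at order 2
    the new product is C_1 B_1, with coefficient -1/b.\<close>
  have AC: "A h = C h * B h" for h
    using inverse_mult_eq_1[OF b0[of h]] by (simp add: C_def mult.assoc)
  have 0: "fps_nth (C h) 0 = a / b" for h
  proof -
    have "a = fps_nth (C h) 0 * b" by (metis A(1) B(1) AC fps_mult_nth_0)
    with b show ?thesis by simp
  qed
  have 1: "fps_nth (C h) 1 = fps_nth (A h) 1 / b - a / b / b * fps_nth (B h) 1" for h
  proof -
    have "fps_nth (A h) 1 = a / b * fps_nth (B h) 1 + fps_nth (C h) 1 * b"
      unfolding AC[of h] by (simp add: fps_mult_nth B(1) 0)
    with b show ?thesis by (simp add: field_simps)
  qed
  have 2: "fps_nth (C h) 2 = fps_nth (A h) 2 / b - a / b / b * fps_nth (B h) 2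
      - fps_nth (C h) 1 * fps_nth (B h) 1 / b" for h
  proof -
    have "fps_nth (A h) 2 = a / b * fps_nth (B h) 2 + fps_nth (C h) 1 * fps_nth (B h) 1
        + fps_nth (C h) 2 * b"
      unfolding AC[of h] using B(1)[of h] 0[of h] by (simp add: fps_mult_nth numeral_2_eq_2)
    with b show ?thesis by (simp add: field_simps)
  qed
  show ?thesis
  proof (rule quadratic_jetsI[where c = "a / b" and
        \<gamma> = "(\<lambda>j. \<gamma> j / b - a / b / b * \<delta> j)(r := - 1 / b)"])
    show "linear_form (\<lambda>h. fps_nth (C h) 1)"
      unfolding 1 using A(2) B(2)
      by (simp add: linear_form_on_def algebra_simps add_divide_distrib)
    fix h
    show "fps_nth (C h) 2 = (\<Sum>j<Suc r. ((\<lambda>j. \<gamma> j / b - a / b / b * \<delta> j)(r := - 1 / b)) j *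
        ((l(r := \<lambda>h. fps_nth (C h) 1)) j h * (m(r := \<lambda>h. fps_nth (B h) 1)) j h))"
      unfolding 2 A(3) B(3)
      by (simp add: algebra_simps sum_subtractf sum_distrib_left sum_divide_distrib)
  qed (rule 0)
qed

lemma operand_jet:
  assumes "\<forall>i<length rs. F i \<in> quadratic_jets r l m \<and> (\<forall>h. has_jet x h (rs ! i) (F i h))"
    and "operand_ok V (length rs) a"
  shows "\<exists>A\<in>quadratic_jets r l m. \<forall>h. has_jet x h (operand_val rs a) (A h)"
proof (cases a)
  case (Input v)
  then show ?thesis
    by (auto intro!: bexI[OF _ quadratic_jets_var[where a = "x v" and v = v]] has_jet_var)
next
  case (Const c)
  then show ?thesis
    by (auto intro!: bexI[OF _ quadratic_jets_const[where c = c]] has_jet_const)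
next
  case (Result i)
  then show ?thesis using assms by auto
qed

text \<open>Turns a nonzero divisor into a polynomial condition on the base point: N is the
  numerator of f, and F * D = N along the line has constant term N(x), so F cannot start with
  0.\<close>

lemma nonzero_generic_jet:
  fixes f :: "('v::linorder, 'k::field) rational_function"
  assumes "f \<noteq> 0"
  obtains N where "N \<noteq> 0"
    "\<And>x h F. eval_poly x N \<noteq> 0 \<Longrightarrow> has_jet x h f F \<Longrightarrow> fps_nth F 0 \<noteq> 0"
proof -
  obtain N D where f: "f = Fraction_Field.Fract N D" and D: "D \<noteq> 0" by (cases f) auto
  have "N \<noteq> 0" using assms f by (auto simp: fract_collapse)
  moreover have "fps_nth F 0 \<noteq> 0" if "eval_poly x N \<noteq> 0" "has_jet x h f F" for x h F
    using arg_cong[OF has_jet_Fract[OF that(2)[unfolded f] D], of "\<lambda>F. fps_nth F 0"] that(1)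
    by (auto simp: coeff_line_poly_0)
  ultimately show thesis by (rule that)
qed

text \<open>G collects a numerator of each divisor, so a single base point outside its zeros serves
  all instructions. The forms l and m depend on that point, but G does not.\<close>

lemma slp_results_jets:
  fixes rs :: "('v::linorder, 'k::field) rational_function list"
  assumes "slp_results V P rs"
  shows "\<exists>G. G \<noteq> 0 \<and> (\<forall>x. eval_poly x G \<noteq> 0 \<longrightarrow> (\<exists>l m F.
     (\<forall>j<length rs. linear_form (l j) \<and> linear_form (m j)) \<and>
     (\<forall>i<length rs. F i \<in> quadratic_jets (length rs) l m \<and> (\<forall>h. has_jet x h (rs ! i) (F i h)))))"
  using assms
proof induction
  case slp_Nil
  show ?case by (intro exI[of _ 1]) auto
next
  case (slp_snoc P rs a b c)
  obtain G where G: "G \<noteq> 0" and GF: "\<And>x. eval_poly x G \<noteq> 0 \<Longrightarrow> (\<exists>l m F.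
     (\<forall>j<length rs. linear_form (l j) \<and> linear_form (m j)) \<and>
     (\<forall>i<length rs. F i \<in> quadratic_jets (length rs) l m \<and> (\<forall>h. has_jet x h (rs ! i) (F i h))))"
    using slp_snoc.IH by blast
  obtain N where N: "N \<noteq> 0" and ND: "\<And>x h F. c = Div \<Longrightarrow> eval_poly x N \<noteq> 0 \<Longrightarrow>
      has_jet x h (operand_val rs b) F \<Longrightarrow> fps_nth F 0 \<noteq> 0"
  proof (cases "c = Div")
    case True
    then have "operand_val rs b \<noteq> 0" using slp_snoc.hyps by simp
    then show thesis by (rule nonzero_generic_jet) (rule that)
  next
    case False
    then show thesis using that[of 1] by simp
  qed
  let ?r = "length rs"
  let ?f = "apply_op c (operand_val rs a) (operand_val rs b)"
  show ?case
  proof (intro exI[of _ "G * N"] conjI allI impI)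
    show "G * N \<noteq> 0" using G N by simp
    fix x assume x: "eval_poly x (G * N) \<noteq> 0"
    then obtain l m F where lm: "\<forall>j<?r. linear_form (l j) \<and> linear_form (m j)"
      and F: "\<forall>i<?r. F i \<in> quadratic_jets ?r l m \<and> (\<forall>h. has_jet x h (rs ! i) (F i h))"
      using GF[of x] by (auto simp: eval_poly_mult)
    obtain A where A: "A \<in> quadratic_jets ?r l m" "\<And>h. has_jet x h (operand_val rs a) (A h)"
      using operand_jet[OF F slp_snoc.hyps(2)] by blast
    obtain B where B: "B \<in> quadratic_jets ?r l m" "\<And>h. has_jet x h (operand_val rs b) (B h)"
      using operand_jet[OF F slp_snoc.hyps(3)] by blast
    have linA: "linear_form (\<lambda>h. fps_nth (A h) 1)"
      using A(1) by (rule quadratic_jetsE)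
    have linB: "linear_form (\<lambda>h. fps_nth (B h) 1)"
      using B(1) by (rule quadratic_jetsE)
    have "\<exists>l' m' C. linear_form l' \<and> linear_form m' \<and>
        C \<in> quadratic_jets (Suc ?r) (l(?r := l')) (m(?r := m')) \<and> (\<forall>h. has_jet x h ?f (C h))"
    proof (cases c)
      case Add
      then have "\<forall>h. has_jet x h ?f (A h + B h)" using A B by (simp add: has_jet_add)
      then show ?thesis using quadratic_jets_Suc[OF quadratic_jets_add[OF A(1) B(1)]] linA by blast
    next
      case Sub
      then have "\<forall>h. has_jet x h ?f (A h - B h)" using A B by (simp add: has_jet_diff)
      then show ?thesis using quadratic_jets_Suc[OF quadratic_jets_diff[OF A(1) B(1)]] linA by blast
    next
      case Mul
      then have "\<forall>h. has_jet x h ?f (A h * B h)" using A B by (simp add: has_jet_mult)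
      then show ?thesis using quadratic_jets_mult[OF A(1) B(1)] linA linB by blast
    next
      case Div
      have b0: "fps_nth (B h) 0 \<noteq> 0" for h
        using ND[OF Div _ B(2)] x by (auto simp: eval_poly_mult)
      have C: "(\<lambda>h. A h * inverse (B h)) \<in> quadratic_jets (Suc ?r)
          (l(?r := \<lambda>h. fps_nth (A h * inverse (B h)) 1)) (m(?r := \<lambda>h. fps_nth (B h) 1))"
        by (rule quadratic_jets_divide[OF A(1) B(1) b0])
      then have "linear_form (\<lambda>h. fps_nth (A h * inverse (B h)) 1)"
        by (rule quadratic_jetsE)
      moreover have "\<forall>h. has_jet x h ?f (A h * inverse (B h))"
        using has_jet_divide[OF A(2) B(2) b0] Div by simp
      ultimately show ?thesis using C linB by blast
    qed
    then obtain l' m' C where C: "linear_form l'" "linear_form m'"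
        "C \<in> quadratic_jets (Suc ?r) (l(?r := l')) (m(?r := m'))" "\<And>h. has_jet x h ?f (C h)"
      by blast
    show "\<exists>l m F. (\<forall>j<length (rs @ [?f]). linear_form (l j) \<and> linear_form (m j)) \<and>
       (\<forall>i<length (rs @ [?f]). F i \<in> quadratic_jets (length (rs @ [?f])) l m \<and>
          (\<forall>h. has_jet x h ((rs @ [?f]) ! i) (F i h)))"
      using lm F C
      by (intro exI[of _ "l(?r := l')"] exI[of _ "m(?r := m')"] exI[of _ "F(?r := C)"])
        (auto simp: less_Suc_eq nth_append quadratic_jets_Suc)
  qed
qed

subsection \<open>Bilinear decompositions\<close>

lemma sum_fun_apply: "sum f S x = (\<Sum>s\<in>S. f s x)"
  by (induction S rule: infinite_finite_induct) auto

text \<open>The decompositions behind \<open>tensor_rank\<close>, but over an arbitrary index set,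
  so that pairs and quadruples can index products directly; only the cardinality matters for the
  rank.\<close>

definition bilinear_decomposition ::
    "'i set \<Rightarrow> 'j set \<Rightarrow> 'l set \<Rightarrow> (('i \<Rightarrow> 'k::field) \<Rightarrow> ('j \<Rightarrow> 'k) \<Rightarrow> 'l \<Rightarrow> 'k) \<Rightarrow> 's set \<Rightarrow>
     ('s \<Rightarrow> ('i \<Rightarrow> 'k) \<Rightarrow> 'k) \<Rightarrow> ('s \<Rightarrow> ('j \<Rightarrow> 'k) \<Rightarrow> 'k) \<Rightarrow> ('s \<Rightarrow> 'l \<Rightarrow> 'k) \<Rightarrow> bool" where
  "bilinear_decomposition I J L T S \<alpha> \<beta> w \<longleftrightarrow>
     (\<forall>s\<in>S. linear_form_on coord_scale (coord_space I) (\<alpha> s) \<and>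
        linear_form_on coord_scale (coord_space J) (\<beta> s) \<and> w s \<in> coord_space L) \<and>
     (\<forall>u\<in>coord_space I. \<forall>v\<in>coord_space J.
        T u v = (\<Sum>s\<in>S. coord_scale (\<alpha> s u * \<beta> s v) (w s)))"

abbreviation coord_rank ::
    "'i set \<Rightarrow> 'j set \<Rightarrow> 'l set \<Rightarrow> (('i \<Rightarrow> 'k::field) \<Rightarrow> ('j \<Rightarrow> 'k) \<Rightarrow> 'l \<Rightarrow> 'k) \<Rightarrow> nat" where
  "coord_rank I J L \<equiv> tensor_rank coord_scale coord_scale coord_scale
     (coord_space I) (coord_space J) (coord_space L)"

lemma coord_rank_eq:
  "coord_rank I J L T = (LEAST r. \<exists>\<alpha> \<beta> w. bilinear_decomposition I J L T {..<r} \<alpha> \<beta> w)"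
  by (simp add: tensor_rank_def bilinear_decomposition_def Ball_def)

lemma bilinear_decomposition_card:
  assumes "bilinear_decomposition I J L T S \<alpha> \<beta> w" "finite S"
  shows "\<exists>\<alpha> \<beta> w. bilinear_decomposition I J L T {..<card S} \<alpha> \<beta> w"
proof -
  obtain h where h: "bij_betw h {..<card S} S"
    using ex_bij_betw_nat_finite[OF assms(2)] by (auto simp: atLeast0LessThan)
  then have "bilinear_decomposition I J L T {..<card S} (\<alpha> \<circ> h) (\<beta> \<circ> h) (w \<circ> h)"
    using assms(1) bij_betw_apply[OF h]
    by (simp add: bilinear_decomposition_def flip: sum.reindex_bij_betw[OF h])
  then show ?thesis by blast
qed

lemma coord_rank_le:
  assumes "bilinear_decomposition I J L T S \<alpha> \<beta> w" "finite S"
  shows "coord_rank I J L T \<le> card S"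
  unfolding coord_rank_eq by (rule Least_le) (rule bilinear_decomposition_card[OF assms])

lemma coord_rank_decomposition:
  assumes "bilinear_decomposition I J L T S \<alpha> \<beta> w" "finite S"
  obtains \<alpha>' \<beta>' w' where
    "bilinear_decomposition I J L T {..<coord_rank I J L T} \<alpha>' \<beta>' w'"
  using LeastI[of "\<lambda>r. \<exists>\<alpha> \<beta> w. bilinear_decomposition I J L T {..<r} \<alpha> \<beta> w",
      OF bilinear_decomposition_card[OF assms]]
  unfolding coord_rank_eq[symmetric] by blast

definition bilinear_on ::
    "'i set \<Rightarrow> 'j set \<Rightarrow> (('i \<Rightarrow> 'k::field) \<Rightarrow> ('j \<Rightarrow> 'k) \<Rightarrow> 'l \<Rightarrow> 'k) \<Rightarrow> bool" where
  "bilinear_on I J T \<longleftrightarrow>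
     (\<forall>w. \<forall>v\<in>coord_space J. linear_form_on coord_scale (coord_space I) (\<lambda>u. T u v w)) \<and>
     (\<forall>w. \<forall>u\<in>coord_space I. linear_form_on coord_scale (coord_space J) (\<lambda>v. T u v w))"

lemma coord_space_zero [simp]: "0 \<in> coord_space I"
  by (simp add: coord_space_def)

lemma coord_space_add: "(x :: 'i \<Rightarrow> 'k::field) \<in> coord_space I \<Longrightarrow> y \<in> coord_space I \<Longrightarrow> x + y \<in> coord_space I"
  by (simp add: coord_space_def)

lemma coord_space_scale: "(x :: 'i \<Rightarrow> 'k::field) \<in> coord_space I \<Longrightarrow> coord_scale c x \<in> coord_space I"
  by (simp add: coord_space_def coord_scale_def)

lemma linear_form_on_zero:
  assumes "linear_form_on coord_scale (coord_space I) f"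
  shows "f 0 = 0"
proof -
  have "f (coord_scale 0 0) = 0 * f 0"
    using assms unfolding linear_form_on_def by (metis coord_space_zero)
  then show ?thesis by (simp add: coord_scale_def zero_fun_def)
qed

text \<open>The coefficient of t^2 does not involve the base point (x, y), which is why a generic
  one is as good as the origin.\<close>

lemma bilinear_on_line:
  assumes "bilinear_on I J T" "x \<in> coord_space I" "u \<in> coord_space I"
    "y \<in> coord_space J" "v \<in> coord_space J"
  shows "T (x + coord_scale t u) (y + coord_scale t v) w
    = T x y w + t * (T x v w + T u y w) + t\<^sup>2 * T u v w"
proof -
  have l: "T (x + coord_scale t u) z w = T x z w + t * T u z w" if "z \<in> coord_space J" for z
    using assms that coord_space_scale[OF assms(3), of t]
    unfolding bilinear_on_def linear_form_on_def by simp
  have r: "T z (y + coord_scale t v) w = T z y w + t * T z v w" if "z \<in> coord_space I" for z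
    using assms that coord_space_scale[OF assms(5), of t]
    unfolding bilinear_on_def linear_form_on_def by simp
  show ?thesis
    by (simp add: l r assms coord_space_add coord_space_scale algebra_simps power2_eq_square)
qed

subsection \<open>The rank is at most twice the complexity\<close>

text \<open>The values of g are known only at parameters t where the denominator is nonzero. The
  extra factor \<open>?Q\<close> in (g * ?Q - ?P) * ?Q covers the others: this polynomial vanishes
  at every t of an infinite field, hence is 0.\<close>

lemma has_jet_represented:
  fixes x :: "'v::linorder \<Rightarrow> 'k::field_char_0"
  assumes "has_jet x h (Fraction_Field.Fract P Q) F" "eval_poly x Q \<noteq> 0"
    and g: "\<And>t. eval_poly (\<lambda>v. x v + t * h v) Q \<noteq> 0 \<Longrightarrow>
      poly g t = eval_poly (\<lambda>v. x v + t * h v) P / eval_poly (\<lambda>v. x v + t * h v) Q"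
  shows "F = fps_of_poly g"
proof -
  let ?P = "line_poly x h P" and ?Q = "line_poly x h Q"
  have zero: "poly ((g * ?Q - ?P) * ?Q) t = 0" for t
    using g[of t] by (cases "poly ?Q t = 0") (simp_all add: poly_line_poly)
  have "(g * ?Q - ?P) * ?Q = 0"
    using zero poly_all_0_iff_0 by blast
  moreover have "?Q \<noteq> 0" using fps_line_poly_nonzero[OF assms(2), of h] by auto
  ultimately have gQ: "g * ?Q = ?P" by simp
  have "F * fps_of_poly ?Q = fps_of_poly g * fps_of_poly ?Q"
    unfolding has_jet_Fract[OF assms(1) eval_poly_nonzeroD[OF assms(2)]]
      fps_of_poly_mult[symmetric] gQ ..
  then show ?thesis using fps_line_poly_nonzero[OF assms(2)] by simp
qed

definition pair_point :: "('i \<Rightarrow> 'k) \<Rightarrow> ('j \<Rightarrow> 'k) \<Rightarrow> ('i, 'j) pair_coord \<Rightarrow> 'k" where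
  "pair_point u v = (\<lambda>c. case c of Fst_Coord i \<Rightarrow> u i | Snd_Coord j \<Rightarrow> v j)"

lemma pair_point_simps [simp]:
  "pair_point u v (Fst_Coord i) = u i" "pair_point u v (Snd_Coord j) = v j"
  by (simp_all add: pair_point_def)

lemma pair_point_eqI:
  "(\<And>i. x (Fst_Coord i) = u i) \<Longrightarrow> (\<And>j. x (Snd_Coord j) = v j) \<Longrightarrow> x = pair_point u v"
  by (rule ext) (auto simp: pair_point_def split: pair_coord.split)

lemma pair_point_coord_space:
  fixes u :: "'i \<Rightarrow> 'k::zero" and v :: "'j \<Rightarrow> 'k"
  shows "pair_point u v \<in> coord_space (pair_coords I J) \<longleftrightarrow> u \<in> coord_space I \<and> v \<in> coord_space J"
proof -
  have all: "(\<forall>c. A c) \<longleftrightarrow> (\<forall>i. A (Fst_Coord i)) \<and> (\<forall>j. A (Snd_Coord j))"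
    for A :: "('i, 'j) pair_coord \<Rightarrow> bool"
    by (auto intro: pair_coord.induct)
  have "Fst_Coord i \<in> pair_coords I J \<longleftrightarrow> i \<in> I" "Snd_Coord j \<in> pair_coords I J \<longleftrightarrow> j \<in> J" for i j
    by (auto simp: pair_coords_def)
  then show ?thesis by (simp add: coord_space_def all)
qed

text \<open>Polarization: \<open>T\<close> vanishes on \<open>u = 0\<close> and on \<open>v = 0\<close>, so only the mixed terms of each
  product survive.\<close>

lemma bilinear_from_quadratic:
  assumes l: "linear_form_on coord_scale UNIV l" and m: "linear_form_on coord_scale UNIV m"
  shows "l (pair_point u v) * m (pair_point u v) =
    l (pair_point u 0) * m (pair_point u 0) + l (pair_point 0 v) * m (pair_point 0 v) +
    (l (pair_point u 0) * m (pair_point 0 v) + m (pair_point u 0) * l (pair_point 0 v))"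
proof -
  have "pair_point u 0 + pair_point 0 v = pair_point u v"
    by (rule pair_point_eqI) auto
  then have "l (pair_point u v) = l (pair_point u 0) + l (pair_point 0 v)"
    "m (pair_point u v) = m (pair_point u 0) + m (pair_point 0 v)"
    using l m unfolding linear_form_on_def by (metis UNIV_I)+
  then show ?thesis by (simp add: algebra_simps)
qed

lemma linear_form_pair_point:
  fixes l :: "(('i, 'j) pair_coord \<Rightarrow> 'k::field) \<Rightarrow> 'k"
  assumes "linear_form_on coord_scale UNIV l"
  shows "linear_form_on coord_scale U (\<lambda>u. l (pair_point u 0))"
    "linear_form_on coord_scale U' (\<lambda>v. l (pair_point 0 v))"
proof -
  have "pair_point (x + y) (0 :: 'j \<Rightarrow> 'k) = pair_point x 0 + pair_point y 0"
    "pair_point (0 :: 'i \<Rightarrow> 'k) (x' + y') = pair_point 0 x' + pair_point 0 y'"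
    "pair_point (coord_scale c x) (0 :: 'j \<Rightarrow> 'k) = coord_scale c (pair_point x 0)"
    "pair_point (0 :: 'i \<Rightarrow> 'k) (coord_scale c x') = coord_scale c (pair_point 0 x')"
    for x y :: "'i \<Rightarrow> 'k" and x' y' :: "'j \<Rightarrow> 'k" and c
    by (rule pair_point_eqI[symmetric]; simp add: coord_scale_def)+
  then show "linear_form_on coord_scale U (\<lambda>u. l (pair_point u 0))"
    "linear_form_on coord_scale U' (\<lambda>v. l (pair_point 0 v))"
    using assms unfolding linear_form_on_def by simp_all
qed

lemma slp_quadratic_part:
  fixes T :: "('i::countable \<Rightarrow> 'k::field_char_0) \<Rightarrow> ('j::countable \<Rightarrow> 'k) \<Rightarrow> 'l \<Rightarrow> 'k"
  assumes T: "bilinear_on I J T" and "finite W"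
    and "slp_computes (pair_coords I J) W P (map_on_pair T)"
  obtains r l m \<gamma> where "r = length P"
    "\<And>j. j < r \<Longrightarrow> linear_form_on coord_scale UNIV (l j)"
    "\<And>j. j < r \<Longrightarrow> linear_form_on coord_scale UNIV (m j)"
    "\<And>u v w. u \<in> coord_space I \<Longrightarrow> v \<in> coord_space J \<Longrightarrow> w \<in> W \<Longrightarrow>
       T u v w = (\<Sum>j<r. \<gamma> w j * (l j (pair_point u v) * m j (pair_point u v)))"
proof -
  let ?V = "pair_coords I J"
  obtain rs where rs: "slp_results ?V P rs"
    and out: "\<forall>w\<in>W. \<exists>a. operand_ok ?V (length rs) a \<and>
      represents ?V (operand_val rs a) (\<lambda>x. map_on_pair T x w)"
    using assms(3) unfolding slp_computes_def by blast
  have len: "length rs = length P" using rs by induction auto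
  have "\<forall>w\<in>W. \<exists>a N D. operand_ok ?V (length rs) a \<and> poly_in ?V N \<and> poly_in ?V D \<and> D \<noteq> 0 \<and>
      operand_val rs a = Fraction_Field.Fract N D \<and>
      (\<forall>x\<in>coord_space ?V. eval_poly x D \<noteq> 0 \<longrightarrow>
        map_on_pair T x w = eval_poly x N / eval_poly x D)"
    using out unfolding represents_def by blast
  then obtain a N D where ND: "\<And>w. w \<in> W \<Longrightarrow> operand_ok ?V (length rs) (a w) \<and>
      poly_in ?V (N w) \<and> poly_in ?V (D w) \<and> D w \<noteq> 0 \<and>
      operand_val rs (a w) = Fraction_Field.Fract (N w) (D w) \<and>
      (\<forall>x\<in>coord_space ?V. eval_poly x (D w) \<noteq> 0 \<longrightarrow>
        map_on_pair T x w = eval_poly x (N w) / eval_poly x (D w))"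
    by metis
  obtain G where G: "G \<noteq> 0" and GF: "\<And>x. eval_poly x G \<noteq> 0 \<Longrightarrow> (\<exists>l m F.
     (\<forall>j<length rs. linear_form (l j) \<and> linear_form (m j)) \<and>
     (\<forall>i<length rs. F i \<in> quadratic_jets (length rs) l m \<and> (\<forall>h. has_jet x h (rs ! i) (F i h))))"
    using slp_results_jets[OF rs] by blast
  \<comment> \<open>The base point must avoid the denominators of the output representations as well
    as the zeros of all divisors.\<close>
  have "G * (\<Prod>w\<in>W. D w) \<noteq> 0" using G ND \<open>finite W\<close> by simp
  then obtain x where x: "eval_poly x (G * (\<Prod>w\<in>W. D w)) \<noteq> 0" by (rule poly_nonzero_value)
  have "eval_poly x (\<Prod>w\<in>W. D w) = (\<Prod>w\<in>W. eval_poly x (D w))"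
    by (induction W rule: infinite_finite_induct) (simp_all add: eval_poly_mult)
  with x \<open>finite W\<close> have xG: "eval_poly x G \<noteq> 0" and xD: "\<And>w. w \<in> W \<Longrightarrow> eval_poly x (D w) \<noteq> 0"
    by (auto simp: eval_poly_mult)
  obtain l m F where lm: "\<forall>j<length rs. linear_form (l j) \<and> linear_form (m j)"
    and F: "\<forall>i<length rs. F i \<in> quadratic_jets (length rs) l m \<and> (\<forall>h. has_jet x h (rs ! i) (F i h))"
    using GF[OF xG] by blast
  have "\<exists>\<gamma>. \<forall>u\<in>coord_space I. \<forall>v\<in>coord_space J.
      T u v w = (\<Sum>j<length rs. \<gamma> j * (l j (pair_point u v) * m j (pair_point u v)))"
    if w: "w \<in> W" for w
  proof -
    have pN: "poly_in ?V (N w)" and pD: "poly_in ?V (D w)"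
      and val: "\<And>x. x \<in> coord_space ?V \<Longrightarrow> eval_poly x (D w) \<noteq> 0 \<Longrightarrow>
        map_on_pair T x w = eval_poly x (N w) / eval_poly x (D w)"
      using ND[OF w] by blast+
    obtain A where A: "A \<in> quadratic_jets (length rs) l m"
        "\<And>h. has_jet x h (operand_val rs (a w)) (A h)"
      using operand_jet[OF F] ND[OF w] by blast
    obtain c \<gamma> where \<gamma>: "\<And>h. fps_nth (A h) 2 = (\<Sum>j<length rs. \<gamma> j * (l j h * m j h))"
      using A(1) by (rule quadratic_jetsE) (rule that)
    have "T u v w = fps_nth (A (pair_point u v)) 2"
      if u: "u \<in> coord_space I" and v: "v \<in> coord_space J" for u v
    proof -
      \<comment> \<open>The point x may have nonzero coordinates outside \<open>?V\<close>, whereas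
        \<open>represents\<close> speaks only about \<open>coord_space ?V\<close>. Truncation does
        not change the values of \<open>N w\<close> and \<open>D w\<close>, which involve only
        variables from \<open>?V\<close>.\<close>
      define x1 where "x1 = (\<lambda>i. if i \<in> I then x (Fst_Coord i) else 0)"
      define x2 where "x2 = (\<lambda>j. if j \<in> J then x (Snd_Coord j) else 0)"
      have x12: "x1 \<in> coord_space I" "x2 \<in> coord_space J"
        by (simp_all add: coord_space_def x1_def x2_def)
      define g where "g = [:T x1 x2 w, T x1 v w + T u x2 w, T u v w:]"
      have "A (pair_point u v) = fps_of_poly g"
      proof (rule has_jet_represented)
        show "has_jet x (pair_point u v) (Fraction_Field.Fract (N w) (D w)) (A (pair_point u v))"
          using A(2) ND[OF w] by metis
        show "eval_poly x (D w) \<noteq> 0" by (rule xD[OF w])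
        fix t
        let ?x = "\<lambda>c. x c + t * pair_point u v c"
        let ?u = "x1 + coord_scale t u" and ?v = "x2 + coord_scale t v"
        assume D: "eval_poly ?x (D w) \<noteq> 0"
        have uv: "?u \<in> coord_space I" "?v \<in> coord_space J" "coord_scale t u \<in> coord_space I"
            "coord_scale t v \<in> coord_space J"
          using u v x12 by (simp_all add: coord_space_add coord_space_scale)
        have eq: "eval_poly ?x p = eval_poly (pair_point ?u ?v) p" if "poly_in ?V p" for p
          by (rule eval_poly_cong[OF that])
            (auto simp: pair_coords_def x1_def x2_def coord_scale_def)
        have "T ?u ?v w = map_on_pair T (pair_point ?u ?v) w"
          by (simp only: map_on_pair_def pair_point_simps)
        also have "\<dots> = eval_poly (pair_point ?u ?v) (N w) / eval_poly (pair_point ?u ?v) (D w)"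
        proof (rule val)
          show "pair_point ?u ?v \<in> coord_space ?V" using uv by (simp only: pair_point_coord_space)
          show "eval_poly (pair_point ?u ?v) (D w) \<noteq> 0" using D unfolding eq[OF pD] .
        qed
        also have "\<dots> = eval_poly ?x (N w) / eval_poly ?x (D w)"
          by (simp only: eq[OF pD] eq[OF pN])
        finally have "T ?u ?v w = eval_poly ?x (N w) / eval_poly ?x (D w)" .
        moreover have "T ?u ?v w = poly g t"
          using bilinear_on_line[OF T x12(1) u x12(2) v, of t w]
          by (simp add: g_def algebra_simps power2_eq_square)
        ultimately show "poly g t = eval_poly ?x (N w) / eval_poly ?x (D w)" by simp
      qed
      then show ?thesis by (simp add: g_def numeral_2_eq_2)
    qed
    then show ?thesis by (auto simp: \<gamma>)
  qed
  then have "\<exists>\<gamma>. \<forall>w\<in>W. \<forall>u\<in>coord_space I. \<forall>v\<in>coord_space J.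
      T u v w = (\<Sum>j<length rs. \<gamma> w j * (l j (pair_point u v) * m j (pair_point u v)))"
    by (intro bchoice ballI)
  then obtain \<gamma> where \<gamma>: "\<forall>w\<in>W. \<forall>u\<in>coord_space I. \<forall>v\<in>coord_space J.
      T u v w = (\<Sum>j<length rs. \<gamma> w j * (l j (pair_point u v) * m j (pair_point u v)))"
    by (elim exE)
  show thesis
    by (rule that[of "length rs" l m \<gamma>]) (simp_all add: len lm[rule_format] \<gamma>[rule_format])
qed

theorem slp_bilinear_decomposition:
  fixes T :: "('i::countable \<Rightarrow> 'k::field_char_0) \<Rightarrow> ('j::countable \<Rightarrow> 'k) \<Rightarrow> 'l \<Rightarrow> 'k"
  assumes T: "bilinear_on I J T" and W: "finite W"
    and TW: "\<And>u v. u \<in> coord_space I \<Longrightarrow> v \<in> coord_space J \<Longrightarrow> T u v \<in> coord_space W"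
    and P: "slp_computes (pair_coords I J) W P (map_on_pair T)"
  obtains \<alpha> \<beta> w where
    "bilinear_decomposition I J W T ({..<length P} \<times> (UNIV :: bool set)) \<alpha> \<beta> w"
proof -
  obtain r l m \<gamma> where r: "r = length P"
    and l: "\<And>j. j < r \<Longrightarrow> linear_form (l j)" and m: "\<And>j. j < r \<Longrightarrow> linear_form (m j)"
    and \<gamma>: "\<And>u v w. u \<in> coord_space I \<Longrightarrow> v \<in> coord_space J \<Longrightarrow> w \<in> W \<Longrightarrow>
       T u v w = (\<Sum>j<r. \<gamma> w j * (l j (pair_point u v) * m j (pair_point u v)))"
    by (rule slp_quadratic_part[OF T W P]) (rule that)
  \<comment> \<open>The flag b selects one of the two mixed terms of the polarized product: l(u)
    m(v) for True and m(u) l(v) for False.\<close>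
  define \<alpha> where "\<alpha> = (\<lambda>(j, b) u. (if b then l j else m j) (pair_point u 0))"
  define \<beta> where "\<beta> = (\<lambda>(j, b) v. (if b then m j else l j) (pair_point 0 v))"
  define c where "c = (\<lambda>(j, b::bool) w. if w \<in> W then \<gamma> w j else 0)"
  have "bilinear_decomposition I J W T ({..<r} \<times> (UNIV :: bool set)) \<alpha> \<beta> c"
    unfolding bilinear_decomposition_def
  proof (intro conjI ballI)
    fix s :: "nat \<times> bool" assume "s \<in> {..<r} \<times> UNIV"
    then show "linear_form_on coord_scale (coord_space I) (\<alpha> s)"
      "linear_form_on coord_scale (coord_space J) (\<beta> s)"
      using l m by (auto simp: \<alpha>_def \<beta>_def linear_form_pair_point)
    show "c s \<in> coord_space W" by (simp add: c_def coord_space_def split_beta)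
  next
    fix u :: "'i \<Rightarrow> 'k" and v :: "'j \<Rightarrow> 'k"
    assume u: "u \<in> coord_space I" and v: "v \<in> coord_space J"
    show "T u v = (\<Sum>s\<in>{..<r} \<times> UNIV. coord_scale (\<alpha> s u * \<beta> s v) (c s))"
    proof
      fix w
      show "T u v w = (\<Sum>s\<in>{..<r} \<times> UNIV. coord_scale (\<alpha> s u * \<beta> s v) (c s)) w"
      proof (cases "w \<in> W")
        case False
        then have "T u v w = 0" using TW[OF u v] by (simp add: coord_space_def)
        then show ?thesis
          using False by (simp add: sum_fun_apply coord_scale_def c_def split_beta)
      next
        case True
        let ?q = "\<lambda>u v. \<Sum>j<r. \<gamma> w j * (l j (pair_point u v) * m j (pair_point u v))"
        have "T u 0 w = 0" "T 0 v w = 0"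
          using T u v linear_form_on_zero[of J "\<lambda>v. T u v w"] linear_form_on_zero[of I "\<lambda>u. T u v w"]
          unfolding bilinear_on_def by auto
        \<comment> \<open>The pure terms need not vanish for a single j; only their weighted sums
          do, being the values T u 0 w and T 0 v w.\<close>
        then have 0: "?q u 0 = 0" "?q 0 v = 0"
          using \<gamma>[OF u coord_space_zero True] \<gamma>[OF coord_space_zero v True] by simp_all
        have "T u v w = ?q u v" by (rule \<gamma>[OF u v True])
        also have "\<dots> = (\<Sum>j<r. \<gamma> w j * (l j (pair_point u 0) * m j (pair_point u 0)) +
            \<gamma> w j * (l j (pair_point 0 v) * m j (pair_point 0 v)) +
            (\<gamma> w j * (l j (pair_point u 0) * m j (pair_point 0 v)) +
             \<gamma> w j * (m j (pair_point u 0) * l j (pair_point 0 v))))"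
          by (rule sum.cong)
            (auto simp: bilinear_from_quadratic[OF l m, of _ _ u v] distrib_left)
        also have "\<dots> = ?q u 0 + ?q 0 v +
            (\<Sum>j<r. \<gamma> w j * (l j (pair_point u 0) * m j (pair_point 0 v)) +
              \<gamma> w j * (m j (pair_point u 0) * l j (pair_point 0 v)))"
          by (simp only: sum.distrib)
        also have "\<dots> = (\<Sum>s\<in>{..<r} \<times> UNIV. \<alpha> s u * \<beta> s v * c s w)"
        proof -
          have "(\<Sum>s\<in>{..<r} \<times> UNIV. \<alpha> s u * \<beta> s v * c s w)
              = (\<Sum>j<r. \<Sum>b\<in>UNIV. \<alpha> (j, b) u * \<beta> (j, b) v * c (j, b) w)"
            by (simp add: sum.cartesian_product split_def)
          then show ?thesis
            unfolding 0 using True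
            by (simp add: UNIV_bool \<alpha>_def \<beta>_def c_def mult_ac add.commute)
        qed
        finally show ?thesis by (simp add: sum_fun_apply coord_scale_def)
      qed
    qed
  qed
  then show thesis using that r by blast
qed

section \<open>Complexity bounded by rank: programs built from bilinear decompositions\<close>

subsection \<open>Cost of computing further values\<close>

definition available ::
    "'v set \<Rightarrow> ('v::linorder, 'k::field) rational_function list \<Rightarrow> ('v, 'k) rational_function set" where
  "available V rs = {operand_val rs a | a. operand_ok V (length rs) a}"

text \<open>Quantifying over every program that already provides X lets costs add up under
  concatenation: values computed earlier remain available and references to them stay valid.\<close>

definition computable ::
    "'v set \<Rightarrow> ('v::linorder, 'k::field) rational_function set \<Rightarrow> nat \<Rightarrow>
     ('v, 'k) rational_function set \<Rightarrow> bool" where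
  "computable V X n Y \<longleftrightarrow> (\<forall>P rs. slp_results V P rs \<longrightarrow> X \<subseteq> available V rs \<longrightarrow>
     (\<exists>P' rs'. slp_results V (P @ P') (rs @ rs') \<and> length P' \<le> n \<and> Y \<subseteq> available V (rs @ rs')))"

lemma operand_append:
  assumes "operand_ok V (length rs) a"
  shows "operand_ok V (length (rs @ rs')) a" "operand_val (rs @ rs') a = operand_val rs a"
  using assms by (cases a; simp add: nth_append)+

lemma available_append: "available V rs \<subseteq> available V (rs @ rs')"
proof
  fix x assume "x \<in> available V rs"
  then obtain a where a: "operand_ok V (length rs) a" "x = operand_val rs a"
    unfolding available_def by blast
  then show "x \<in> available V (rs @ rs')"
    using operand_append[OF a(1), of rs'] unfolding available_def mem_Collect_eq
    by (intro exI[of _ a]) simp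
qed

lemma available_const: "rat_const c \<in> available V rs"
  unfolding available_def by (auto intro!: exI[of _ "Const c"])

lemma computable_subset: "Y \<subseteq> X \<Longrightarrow> computable V X n Y"
  unfolding computable_def by (metis append_Nil2 le0 list.size(3) order_trans)

lemma computable_mono:
  assumes "computable V X n Y" "X \<subseteq> X'" "n \<le> n'" "Y' \<subseteq> Y"
  shows "computable V X' n' Y'"
  using assms unfolding computable_def by (meson order_trans)

text \<open>Constants are operands in their own right, so they may be assumed among the given values
  at no cost.\<close>

lemma computable_consts:
  assumes "computable V (X \<union> range rat_const) n Y"
  shows "computable V X n Y"
  unfolding computable_def
proof (intro allI impI)
  fix P rs assume "slp_results V P rs" "X \<subseteq> available V rs"
  moreover have "range rat_const \<subseteq> available V rs" using available_const by blast
  ultimately show "\<exists>P' rs'. slp_results V (P @ P') (rs @ rs') \<and> length P' \<le> n \<and>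
      Y \<subseteq> available V (rs @ rs')"
    using assms unfolding computable_def by simp
qed

lemma computable_trans:
  assumes "computable V X m Y" "computable V (X \<union> Y) n Z"
  shows "computable V X (m + n) (Y \<union> Z)"
  unfolding computable_def
proof (intro allI impI)
  fix P rs assume P: "slp_results V P rs" and X: "X \<subseteq> available V rs"
  obtain P1 rs1 where 1: "slp_results V (P @ P1) (rs @ rs1)" "length P1 \<le> m"
      "Y \<subseteq> available V (rs @ rs1)"
    using assms(1) P X unfolding computable_def by blast
  have "X \<union> Y \<subseteq> available V (rs @ rs1)" using X 1(3) available_append[of V rs rs1] by blast
  then obtain P2 rs2 where 2: "slp_results V ((P @ P1) @ P2) ((rs @ rs1) @ rs2)" "length P2 \<le> n"
      "Z \<subseteq> available V ((rs @ rs1) @ rs2)"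
    using assms(2) 1(1) unfolding computable_def by blast
  have "Y \<subseteq> available V ((rs @ rs1) @ rs2)" using 1(3) available_append[of V "rs @ rs1" rs2] by blast
  with 1 2 show "\<exists>P' rs'. slp_results V (P @ P') (rs @ rs') \<and> length P' \<le> m + n \<and>
      Y \<union> Z \<subseteq> available V (rs @ rs')"
    by (intro exI[of _ "P1 @ P2"] exI[of _ "rs1 @ rs2"]) simp
qed

lemma computable_Un:
  assumes "computable V X m Y" "computable V X n Z"
  shows "computable V X (m + n) (Y \<union> Z)"
  using computable_trans[OF assms(1) computable_mono[OF assms(2)]] by simp

lemma computable_UN:
  assumes "finite S" "\<And>s. s \<in> S \<Longrightarrow> computable V X (c s) (Y s)"
  shows "computable V X (\<Sum>s\<in>S. c s) (\<Union>s\<in>S. Y s)"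
  using assms
proof (induction S rule: finite_induct)
  case (insert s S)
  then have "computable V X (c s + (\<Sum>s\<in>S. c s)) (Y s \<union> (\<Union>s\<in>S. Y s))"
    by (intro computable_Un) auto
  then show ?case using insert.hyps by simp
qed (simp add: computable_subset)

lemma computable_image:
  assumes "finite S" "\<And>s. s \<in> S \<Longrightarrow> computable V X c {y s}"
  shows "computable V X (card S * c) (y ` S)"
  using computable_UN[of S V X "\<lambda>_. c" "\<lambda>s. {y s}"] assms by (simp add: UNION_singleton_eq_range)

text \<open>All programs built from decompositions are free of divisions, so no condition on nonzero
  divisors has to be carried along.\<close>

lemma computable_op:
  assumes "x \<in> X" "y \<in> X" "c \<noteq> Div"
  shows "computable V X 1 {apply_op c x y}"
  unfolding computable_def
proof (intro allI impI)
  fix P rs assume P: "slp_results V P rs" and X: "X \<subseteq> available V rs"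
  obtain a where a: "operand_ok V (length rs) a" "x = operand_val rs a"
    using assms(1) X unfolding available_def by blast
  obtain b where b: "operand_ok V (length rs) b" "y = operand_val rs b"
    using assms(2) X unfolding available_def by blast
  have "slp_results V (P @ [(c, a, b)]) (rs @ [apply_op c x y])"
    unfolding a(2) b(2) by (rule slp_snoc[OF P a(1) b(1)]) (use assms(3) in simp)
  moreover have "apply_op c x y \<in> available V (rs @ [apply_op c x y])"
    unfolding available_def by (auto intro!: exI[of _ "Result (length rs)"])
  ultimately show "\<exists>P' rs'. slp_results V (P @ P') (rs @ rs') \<and> length P' \<le> 1 \<and>
      {apply_op c x y} \<subseteq> available V (rs @ rs')"
    by (intro exI[of _ "[(c, a, b)]"] exI[of _ "[apply_op c x y]"]) simp
qed

lemma rat_const_0 [simp]: "rat_const 0 = 0"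
  by (simp add: rat_const_def fract_collapse)

lemma rat_const_1 [simp]: "rat_const 1 = 1"
  by (simp add: rat_const_def fract_collapse)

lemma rat_const_add: "rat_const (a + b) = rat_const a + rat_const b"
  by (simp add: rat_const_def single_add)

lemma rat_const_mult: "rat_const (a * b) = rat_const a * rat_const b"
  by (simp add: rat_const_def mult_single)

lemma rat_const_sum: "rat_const (sum f S) = (\<Sum>s\<in>S. rat_const (f s))"
  by (induction S rule: infinite_finite_induct) (simp_all add: rat_const_add)

text \<open>Each term costs one multiplication by its coefficient and one addition. The sum starts
  from the free constant 0, so the first addition is counted as well.\<close>

lemma computable_linear_combination:
  assumes "finite S" "x ` S \<subseteq> X"
  shows "computable V X (2 * card S) {\<Sum>s\<in>S. rat_const (a s) * x s}"
  using assms
proof (induction S rule: finite_induct)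
  case empty
  have "computable V (X \<union> range rat_const) 0 {rat_const 0}"
    by (rule computable_subset) (auto simp del: rat_const_0)
  then show ?case using computable_consts by fastforce
next
  case (insert s S)
  let ?z = "\<Sum>s\<in>S. rat_const (a s) * x s" and ?y = "rat_const (a s) * x s"
  have "computable V (X \<union> range rat_const) 1 {apply_op Mul (rat_const (a s)) (x s)}"
    using insert.prems by (intro computable_op) auto
  then have "computable V X 1 {?y}" using computable_consts by simp
  then have "computable V X (2 * card S + 1) ({?z} \<union> {?y})"
    using insert by (intro computable_Un) auto
  moreover have "computable V (X \<union> ({?z} \<union> {?y})) 1 {apply_op Add ?y ?z}"
    by (intro computable_op) auto
  ultimately have "computable V X (2 * card S + 1 + 1) (({?z} \<union> {?y}) \<union> {apply_op Add ?y ?z})"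
    by (rule computable_trans)
  then show ?case by (rule computable_mono) (use insert.hyps in auto)
qed

subsection \<open>Matrix multiplication by recursion on blocks\<close>

text \<open>The type argument fixes the field of constants, which does not occur in \<open>V\<close>.\<close>

definition mm_computable :: "'v::linorder set \<Rightarrow> 'k::field itself \<Rightarrow> nat \<Rightarrow> nat \<Rightarrow> bool" where
  "mm_computable V K n c \<longleftrightarrow>
     (\<forall>X (A :: nat \<Rightarrow> nat \<Rightarrow> ('v, 'k) rational_function) B.
        (\<forall>i<n. \<forall>j<n. A i j \<in> X \<and> B i j \<in> X) \<longrightarrow>
        computable V X c ((\<lambda>(i, j). \<Sum>k<n. A i k * B k j) ` ({..<n} \<times> {..<n})))"

lemma mm_computable_1: "mm_computable V K 1 1"
  unfolding mm_computable_def
proof (intro allI impI)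
  fix X and A B :: "nat \<Rightarrow> nat \<Rightarrow> ('a, 'b) rational_function"
  assume "\<forall>i<1. \<forall>j<1. A i j \<in> X \<and> B i j \<in> X"
  then have "computable V X 1 {apply_op Mul (A 0 0) (B 0 0)}"
    by (intro computable_op) auto
  then show "computable V X 1 ((\<lambda>(i, j). \<Sum>k<1. A i k * B k j) ` ({..<1} \<times> {..<1}))"
    by (simp add: lessThan_Suc)
qed

text \<open>Padding with zeros is free because 0 is a constant operand. This extends cost bounds
  from powers of m to all sizes.\<close>

lemma mm_computable_pad:
  assumes "mm_computable V (K :: 'k::field itself) N c" "n \<le> N"
  shows "mm_computable (V :: 'v::linorder set) K n c"
  unfolding mm_computable_def
proof (intro allI impI)
  fix X and A B :: "nat \<Rightarrow> nat \<Rightarrow> ('v, 'k) rational_function"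
  assume AB: "\<forall>i<n. \<forall>j<n. A i j \<in> X \<and> B i j \<in> X"
  define A' where "A' = (\<lambda>i j. if i < n \<and> j < n then A i j else rat_const 0)"
  define B' where "B' = (\<lambda>i j. if i < n \<and> j < n then B i j else rat_const 0)"
  have "\<forall>i<N. \<forall>j<N. A' i j \<in> X \<union> range rat_const \<and> B' i j \<in> X \<union> range rat_const"
    using AB by (auto simp: A'_def B'_def simp del: rat_const_0)
  then have "computable V (X \<union> range rat_const) c
      ((\<lambda>(i, j). \<Sum>k<N. A' i k * B' k j) ` ({..<N} \<times> {..<N}))"
    using assms(1) unfolding mm_computable_def by blast
  then have "computable V X c ((\<lambda>(i, j). \<Sum>k<N. A' i k * B' k j) ` ({..<N} \<times> {..<N}))"
    by (rule computable_consts)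
  moreover have "(\<Sum>k<n. A i k * B k j) = (\<Sum>k<N. A' i k * B' k j)" if "i < n" "j < n" for i j
    using assms(2) that by (intro sum.mono_neutral_cong_left) (auto simp: A'_def B'_def)
  then have "(\<lambda>(i, j). \<Sum>k<n. A i k * B k j) ` ({..<n} \<times> {..<n})
      \<subseteq> (\<lambda>(i, j). \<Sum>k<N. A' i k * B' k j) ` ({..<N} \<times> {..<N})"
    using assms(2) by fastforce
  ultimately show "computable V X c ((\<lambda>(i, j). \<Sum>k<n. A i k * B k j) ` ({..<n} \<times> {..<n}))"
    by (rule computable_mono[OF _ order_refl order_refl])
qed

text \<open>The third factor is not transposed: \<open>w t e f\<close> belongs to the entry \<open>(e, f)\<close> of the product.\<close>

definition mm_decomposition ::
    "nat \<Rightarrow> nat \<Rightarrow> (nat \<Rightarrow> nat \<Rightarrow> nat \<Rightarrow> 'k::field) \<Rightarrow> (nat \<Rightarrow> nat \<Rightarrow> nat \<Rightarrow> 'k) \<Rightarrow>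
     (nat \<Rightarrow> nat \<Rightarrow> nat \<Rightarrow> 'k) \<Rightarrow> bool" where
  "mm_decomposition m r \<alpha> \<beta> w \<longleftrightarrow>
     (\<forall>a<m. \<forall>b<m. \<forall>c<m. \<forall>d<m. \<forall>e<m. \<forall>f<m.
        (\<Sum>t<r. \<alpha> t a b * \<beta> t c d * w t e f) = (if a = e \<and> b = c \<and> d = f then 1 else 0))"

lemma sum_lessThan_mult:
  fixes g :: "nat \<Rightarrow> 'a::comm_monoid_add"
  shows "(\<Sum>k<m * N. g k) = (\<Sum>b<m. \<Sum>k<N. g (b * N + k))"
proof -
  have "(\<Sum>k<N. g (b * N + k)) = sum g {b * N..<b * N + N}" for b
    by (rule sum.reindex_bij_witness[of _ "\<lambda>i. i - b * N" "\<lambda>j. b * N + j"]) auto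
  then show ?thesis by (simp add: sum.nat_group)
qed

text \<open>A decomposition for m x m matrices also works when the entries are N x N blocks,
  although blocks do not commute: its coefficients are scalars, and every product keeps the A-factor
  on the left. Summing over t first produces the Kronecker deltas of
  \<open>mm_decomposition\<close>.\<close>

lemma mm_block_identity:
  fixes A B :: "nat \<Rightarrow> nat \<Rightarrow> ('v::linorder, 'k::field) rational_function"
  assumes dec: "mm_decomposition m r \<alpha> \<beta> w" and "e < m" "f < m"
  shows "(\<Sum>t<r. rat_const (w t e f) * (\<Sum>k<N.
      (\<Sum>(a, b)\<in>{..<m} \<times> {..<m}. rat_const (\<alpha> t a b) * A (a * N + i) (b * N + k)) *
      (\<Sum>(c, d)\<in>{..<m} \<times> {..<m}. rat_const (\<beta> t c d) * B (c * N + k) (d * N + j)))) =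
    (\<Sum>k<m * N. A (e * N + i) k * B k (f * N + j))" (is "?L = ?R")
proof -
  let ?\<rho> = "rat_const :: 'k \<Rightarrow> ('v, 'k) rational_function"
  have "?L = (\<Sum>t<r. \<Sum>k<N. \<Sum>c<m. \<Sum>a<m. \<Sum>d<m. \<Sum>b<m. ?\<rho> (\<alpha> t a b * \<beta> t c d * w t e f) *
      (A (a * N + i) (b * N + k) * B (c * N + k) (d * N + j)))"
    by (simp add: sum.cartesian_product[symmetric] sum_distrib_left sum_distrib_right
        rat_const_mult mult_ac)
  also have "\<dots> = (\<Sum>k<N. \<Sum>c<m. \<Sum>a<m. \<Sum>d<m. \<Sum>b<m. \<Sum>t<r. ?\<rho> (\<alpha> t a b * \<beta> t c d * w t e f) *
      (A (a * N + i) (b * N + k) * B (c * N + k) (d * N + j)))"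
    by (simp only: sum.swap[of _ _ "{..<r}"])
  also have "\<dots> = (\<Sum>k<N. \<Sum>c<m. \<Sum>a<m. \<Sum>d<m. \<Sum>b<m.
      (if b = c then if d = f then if a = e then
        A (a * N + i) (b * N + k) * B (c * N + k) (d * N + j) else 0 else 0 else 0))"
    using dec assms(2,3)
    by (intro sum.cong refl)
      (auto simp: mm_decomposition_def simp flip: sum_distrib_right rat_const_sum)
  also have "\<dots> = (\<Sum>k<N. \<Sum>b<m. A (e * N + i) (b * N + k) * B (b * N + k) (f * N + j))"
    using assms(2,3) by (intro sum.cong refl) simp
  also have "\<dots> = ?R"
    by (subst sum.swap) (simp add: sum_lessThan_mult)
  finally show ?thesis .
qed

text \<open>Besides r recursive products of cost c, there are r N^2 entries \<open>S\<close>, as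
  many entries \<open>T\<close>, each a combination of m^2 terms, and m^2 N^2 entries
  \<open>C\<close>, each a combination of r terms. At two operations per term, each of the three
  groups costs 2 r m^2 N^2.\<close>

lemma mm_computable_step:
  assumes dec: "mm_decomposition m r \<alpha> \<beta> (w :: nat \<Rightarrow> nat \<Rightarrow> nat \<Rightarrow> 'k::field)"
    and N: "mm_computable (V :: 'v::linorder set) TYPE('k) N c"
  shows "mm_computable V TYPE('k) (m * N) (r * c + 6 * r * m\<^sup>2 * N\<^sup>2)"
  unfolding mm_computable_def
proof (intro allI impI)
  fix X and A B :: "nat \<Rightarrow> nat \<Rightarrow> ('v, 'k) rational_function"
  assume AB: "\<forall>i<m * N. \<forall>j<m * N. A i j \<in> X \<and> B i j \<in> X"
  have idx: "a * N + i < m * N" if "a < m" "i < N" for a i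
  proof -
    have "a * N + i < Suc a * N" using that by simp
    also have "\<dots> \<le> m * N" using that by (intro mult_right_mono) auto
    finally show ?thesis .
  qed
  define S where "S t i j = (\<Sum>(a, b)\<in>{..<m} \<times> {..<m}.
    rat_const (\<alpha> t a b) * A (a * N + i) (b * N + j))" for t i j
  define T where "T t i j = (\<Sum>(a, b)\<in>{..<m} \<times> {..<m}.
    rat_const (\<beta> t a b) * B (a * N + i) (b * N + j))" for t i j
  define Q where "Q t i j = (\<Sum>k<N. S t i k * T t k j)" for t i j
  define C where "C e i f j = (\<Sum>t<r. rat_const (w t e f) * Q t i j)" for e i f j
  let ?I = "{..<r} \<times> {..<N} \<times> {..<N}"
  define Y1 where "Y1 = (\<lambda>(t, i, j). S t i j) ` ?I"
  define Y2 where "Y2 = (\<lambda>(t, i, j). T t i j) ` ?I"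
  define Y3 where "Y3 = (\<Union>t<r. (\<lambda>(i, j). Q t i j) ` ({..<N} \<times> {..<N}))"
  define Y4 where "Y4 = (\<lambda>(e, i, f, j). C e i f j) ` ({..<m} \<times> {..<N} \<times> {..<m} \<times> {..<N})"
  have "computable V X (card ?I * (2 * card ({..<m} \<times> {..<m}))) Y1"
    unfolding Y1_def
  proof (rule computable_image)
    fix s assume "s \<in> ?I"
    then have "(\<lambda>(a, b). A (a * N + fst (snd s)) (b * N + snd (snd s))) ` ({..<m} \<times> {..<m}) \<subseteq> X"
      using AB idx by auto
    from computable_linear_combination[OF _ this, of V "\<lambda>(a, b). \<alpha> (fst s) a b"]
    show "computable V X (2 * card ({..<m} \<times> {..<m})) {case s of (t, i, j) \<Rightarrow> S t i j}"
      by (simp add: S_def split_def)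
  qed simp
  moreover have "computable V X (card ?I * (2 * card ({..<m} \<times> {..<m}))) Y2"
    unfolding Y2_def
  proof (rule computable_image)
    fix s assume "s \<in> ?I"
    then have "(\<lambda>(a, b). B (a * N + fst (snd s)) (b * N + snd (snd s))) ` ({..<m} \<times> {..<m}) \<subseteq> X"
      using AB idx by auto
    from computable_linear_combination[OF _ this, of V "\<lambda>(a, b). \<beta> (fst s) a b"]
    show "computable V X (2 * card ({..<m} \<times> {..<m})) {case s of (t, i, j) \<Rightarrow> T t i j}"
      by (simp add: T_def split_def)
  qed simp
  ultimately have 12: "computable V X (card ?I * (2 * card ({..<m} \<times> {..<m})) +
      card ?I * (2 * card ({..<m} \<times> {..<m}))) (Y1 \<union> Y2)"
    by (rule computable_Un)
  have 3: "computable V (X \<union> (Y1 \<union> Y2)) (\<Sum>t<r. c) Y3"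
    unfolding Y3_def
  proof (rule computable_UN)
    fix t assume "t \<in> {..<r}"
    then have "\<forall>i<N. \<forall>j<N. S t i j \<in> X \<union> (Y1 \<union> Y2) \<and> T t i j \<in> X \<union> (Y1 \<union> Y2)"
      unfolding Y1_def Y2_def by force
    then show "computable V (X \<union> (Y1 \<union> Y2)) c ((\<lambda>(i, j). Q t i j) ` ({..<N} \<times> {..<N}))"
      using N unfolding mm_computable_def Q_def by blast
  qed simp
  have 4: "computable V (X \<union> ((Y1 \<union> Y2) \<union> Y3))
      (card ({..<m} \<times> {..<N} \<times> {..<m} \<times> {..<N}) * (2 * card {..<r})) Y4"
    unfolding Y4_def
  proof (rule computable_image)
    fix s assume s: "s \<in> {..<m} \<times> {..<N} \<times> {..<m} \<times> {..<N}"
    obtain e i f j where s_eq: "s = (e, i, f, j)" by (cases s) auto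
    have "(\<lambda>t. Q t i j) ` {..<r} \<subseteq> X \<union> ((Y1 \<union> Y2) \<union> Y3)"
      using s unfolding Y3_def s_eq by force
    from computable_linear_combination[OF _ this, of V "\<lambda>t. w t e f"]
    show "computable V (X \<union> ((Y1 \<union> Y2) \<union> Y3)) (2 * card {..<r})
        {case s of (e, i, f, j) \<Rightarrow> C e i f j}"
      by (simp add: C_def s_eq)
  qed simp
  have "computable V X (card ?I * (2 * card ({..<m} \<times> {..<m})) +
      card ?I * (2 * card ({..<m} \<times> {..<m})) + (\<Sum>t<r. c) +
      card ({..<m} \<times> {..<N} \<times> {..<m} \<times> {..<N}) * (2 * card {..<r})) (((Y1 \<union> Y2) \<union> Y3) \<union> Y4)"
    by (rule computable_trans[OF computable_trans[OF 12] 4])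
      (use 3 in \<open>simp add: Un_assoc\<close>)
  moreover have "(\<lambda>(i, j). \<Sum>k<m * N. A i k * B k j) ` ({..<m * N} \<times> {..<m * N}) \<subseteq> Y4"
  proof clarsimp
    fix i j assume ij: "i < m * N" "j < m * N"
    have "C (i div N) (i mod N) (j div N) (j mod N) \<in> Y4"
      using ij unfolding Y4_def
      by (intro image_eqI[of _ _ "(i div N, i mod N, j div N, j mod N)"])
        (auto simp: less_mult_imp_div_less intro!: mod_less_divisor gr0I)
    moreover have "C (i div N) (i mod N) (j div N) (j mod N) = (\<Sum>k<m * N. A i k * B k j)"
      unfolding C_def Q_def S_def T_def
      using mm_block_identity[OF dec, where e = "i div N" and f = "j div N" and N = N and A = A
          and i = "i mod N" and B = B and j = "j mod N"] ij
      by (simp add: less_mult_imp_div_less)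
    ultimately show "(\<Sum>k<m * N. A i k * B k j) \<in> Y4" by simp
  qed
  ultimately show "computable V X (r * c + 6 * r * m\<^sup>2 * N\<^sup>2)
      ((\<lambda>(i, j). \<Sum>k<m * N. A i k * B k j) ` ({..<m * N} \<times> {..<m * N}))"
    by (elim computable_mono) (auto simp: card_cartesian_product power2_eq_square algebra_simps)
qed

subsection \<open>The Moore-Penrose inverse of a matrix of full row rank\<close>

text \<open>A maximal independent set of columns has q elements and forms an invertible q x q matrix
  A; a vector orthogonal to all columns is in the kernel of the transpose of A. The product here is
  bilinear, without conjugation.\<close>

lemma full_row_rank_left_kernel:
  fixes M :: "'k::field mat"
  assumes M: "M \<in> carrier_mat q p" and rank: "vec_space.rank q M = q"
    and w: "w \<in> carrier_vec q" and orth: "\<And>l. l < p \<Longrightarrow> col M l \<bullet> w = 0"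
  shows "w = 0\<^sub>v q"
proof (rule ccontr)
  assume w0: "w \<noteq> 0\<^sub>v q"
  interpret vec_space "TYPE('k)" q .
  have "lin_indpt {}" by (rule finite_lin_indpt2) auto
  then obtain S where S: "maximal S (\<lambda>T. T \<subseteq> set (cols M) \<and> lin_indpt T)"
    using maximal_exists_superset[of "set (cols M)" "\<lambda>T. T \<subseteq> set (cols M) \<and> lin_indpt T" "{}"]
    by auto
  then have S': "S \<subseteq> set (cols M)" "lin_indpt S" by (auto simp: maximal_def)
  have cardS: "card S = q" using rank_card_indpt[OF M S] rank by simp
  have "finite S" using finite_subset[OF S'(1)] by simp
  then obtain vs where vs: "set vs = S" "distinct vs"
    using finite_distinct_list by blast
  have len: "length vs = q" using distinct_card[OF vs(2)] vs(1) cardS by simp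
  have vsc: "set vs \<subseteq> carrier_vec q" using vs(1) S'(1) cols_dim M by blast
  define A where "A = mat_of_cols q vs"
  have A: "A \<in> carrier_mat q q" using mat_of_cols_carrier(1)[of q vs] len by (simp add: A_def)
  have colsA: "cols A = vs" unfolding A_def using cols_mat_of_cols vsc by blast
  have "rank A = q" using lin_indpt_full_rank[OF A] colsA vs S'(2) by simp
  then have "det A \<noteq> 0" using det_rank_iff[OF A] by simp
  then have "det (transpose_mat A) \<noteq> 0" using det_transpose[OF A] by simp
  moreover have "transpose_mat A *\<^sub>v w = 0\<^sub>v q"
  proof (rule eq_vecI)
    fix i assume i: "i < dim_vec (0\<^sub>v q :: 'k vec)"
    then have "col A i \<in> set (cols A)" using A by (auto simp: cols_def)
    then have "col A i \<in> set (cols M)" using colsA vs(1) S'(1) by auto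
    then obtain l where "l < p" "col A i = col M l" using M by (auto simp: cols_def)
    then show "(transpose_mat A *\<^sub>v w) $ i = 0\<^sub>v q $ i" using orth i A by simp
  qed (use A in simp)
  ultimately show False
    using w w0 A det_0_iff_vec_prod_zero_field[of "transpose_mat A" q] by auto
qed

lemma mat_adjoint_index:
  "M \<in> carrier_mat q p \<Longrightarrow> l < p \<Longrightarrow> i < q \<Longrightarrow> mat_adjoint M $$ (l, i) = conjugate (M $$ (i, l))"
  by (auto simp: mat_adjoint_def mat_of_rows_index)

lemma mat_adjoint_carrier: "M \<in> carrier_mat q p \<Longrightarrow> mat_adjoint M \<in> carrier_mat p q"
  by (auto simp: mat_adjoint_def)

text \<open>If M M^H v = 0, then u = M^H v has square norm (v, M u) = 0, so u = 0 by positivity. The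
  conjugated entries of u are the products of the columns of M with \<open>conjugate v\<close>,
  which is therefore 0 by full row rank.\<close>

lemma det_gram_nonzero:
  fixes M :: "'k::conjugatable_ordered_field mat"
  assumes M: "M \<in> carrier_mat q p" and rank: "vec_space.rank q M = q"
  shows "det (M * mat_adjoint M) \<noteq> 0"
proof
  let ?H = "mat_adjoint M"
  have H: "?H \<in> carrier_mat p q" by (rule mat_adjoint_carrier[OF M])
  have G: "M * ?H \<in> carrier_mat q q" using M H by simp
  assume "det (M * ?H) = 0"
  then obtain v where v: "v \<in> carrier_vec q" "v \<noteq> 0\<^sub>v q" "(M * ?H) *\<^sub>v v = 0\<^sub>v q"
    using det_0_iff_vec_prod_zero_field[OF G] by blast
  define u where "u = ?H *\<^sub>v v"
  have u: "u \<in> carrier_vec p" using H v(1) by (simp add: u_def)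
  have Mu: "M *\<^sub>v u = 0\<^sub>v q" using v(1,3) M H by (simp add: u_def)
  have conj_u: "conjugate (u $ l) = (\<Sum>i<q. M $$ (i, l) * conjugate (v $ i))" if "l < p" for l
  proof -
    have "u $ l = (\<Sum>i<q. conjugate (M $$ (i, l)) * v $ i)"
      using that v(1) H M mat_adjoint_index[OF M that]
      by (simp add: u_def scalar_prod_def atLeast0LessThan)
    then show ?thesis by (simp add: sum_conjugate conjugate_dist_mul)
  qed
  have "u \<bullet>c u = (\<Sum>l<p. u $ l * (\<Sum>i<q. M $$ (i, l) * conjugate (v $ i)))"
    using u conj_u by (simp add: scalar_prod_def atLeast0LessThan)
  also have "\<dots> = (\<Sum>l<p. \<Sum>i<q. conjugate (v $ i) * (M $$ (i, l) * u $ l))"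
    by (simp add: sum_distrib_left mult_ac)
  also have "\<dots> = (\<Sum>i<q. conjugate (v $ i) * (\<Sum>l<p. M $$ (i, l) * u $ l))"
    by (subst sum.swap) (simp add: sum_distrib_left)
  also have "\<dots> = (\<Sum>i<q. conjugate (v $ i) * (M *\<^sub>v u) $ i)"
    using M u by (intro sum.cong) (auto simp: scalar_prod_def atLeast0LessThan)
  also have "\<dots> = 0" by (simp add: Mu)
  finally have u0: "u = 0\<^sub>v p" using conjugate_square_eq_0_vec[OF u] by simp
  have "conjugate v = 0\<^sub>v q"
  proof (rule full_row_rank_left_kernel[OF M rank])
    show "conjugate v \<in> carrier_vec q" using v(1) by simp
    fix l assume l: "l < p"
    then have "col M l \<bullet> conjugate v = (\<Sum>i<q. M $$ (i, l) * conjugate (v $ i))"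
      using M v(1) by (simp add: scalar_prod_def atLeast0LessThan)
    also have "\<dots> = 0" using conj_u[OF l] u0 l by simp
    finally show "col M l \<bullet> conjugate v = 0" .
  qed
  then have "conjugate (conjugate v) = 0\<^sub>v q" by simp
  with v(2) show False by simp
qed

text \<open>The nonzero determinant ensures that \<open>mat_inverse\<close> really returns an
  inverse. The rank of M enters the rest of the argument only through M M^+ = 1.\<close>

lemma moore_penrose_right_inverse:
  fixes M :: "'k::conjugatable_ordered_field mat"
  assumes M: "M \<in> carrier_mat q p" and rank: "vec_space.rank q M = q"
  shows "moore_penrose M \<in> carrier_mat p q" "M * moore_penrose M = 1\<^sub>m q"
proof -
  let ?H = "mat_adjoint M"
  have H: "?H \<in> carrier_mat p q" by (rule mat_adjoint_carrier[OF M])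
  have G: "M * ?H \<in> carrier_mat q q" using M H by simp
  have "M * ?H \<in> Units (ring_mat TYPE('k) q ())"
    by (rule det_non_zero_imp_unit[OF G det_gram_nonzero[OF M rank]])
  then obtain B where B: "mat_inverse (M * ?H) = Some B"
    using mat_inverse(1)[OF G, where b = "()"] by (cases "mat_inverse (M * ?H)") auto
  then have B': "B \<in> carrier_mat q q" "(M * ?H) * B = 1\<^sub>m q" using mat_inverse(2)[OF G B] by auto
  show "moore_penrose M \<in> carrier_mat p q" using H B'(1) B by (simp add: moore_penrose_def)
  show "M * moore_penrose M = 1\<^sub>m q"
    using B'(2) assoc_mult_mat[OF M H B'(1)] B by (simp add: moore_penrose_def)
qed

subsection \<open>Representing coordinate functions\<close>

lemma poly_in_add: "poly_in V P \<Longrightarrow> poly_in V Q \<Longrightarrow> poly_in V (P + Q)"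
  using keys_add[of P Q] unfolding poly_in_def by blast

lemma poly_in_mult:
  assumes "poly_in V P" "poly_in V Q"
  shows "poly_in V (P * Q)"
  unfolding poly_in_def
proof
  fix m assume "m \<in> Poly_Mapping.keys (P * Q)"
  then obtain a b where ab: "m = a + b" "a \<in> Poly_Mapping.keys P" "b \<in> Poly_Mapping.keys Q"
    using keys_mult[of P Q] by blast
  then show "Poly_Mapping.keys m \<subseteq> V"
    using assms keys_add[of a b] unfolding poly_in_def by blast
qed

lemma represents_const: "represents V (rat_const c) (\<lambda>x. c)"
  unfolding represents_def rat_const_def
  by (intro exI[of _ "Poly_Mapping.single 0 c"] exI[of _ 1])
    (auto simp: poly_in_def eval_poly_single)

lemma represents_var: "v \<in> V \<Longrightarrow> represents V (rat_var v) (\<lambda>x. x v)"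
  unfolding represents_def rat_var_def
  by (intro exI[of _ "Poly_Mapping.single (Poly_Mapping.single v 1) 1"] exI[of _ 1])
    (auto simp: poly_in_def eval_poly_single)

lemma represents_add:
  assumes "represents V f g" "represents V f' g'"
  shows "represents V (f + f') (\<lambda>x. g x + g' x)"
proof -
  obtain P Q P' Q' where PQ: "poly_in V P" "poly_in V Q" "Q \<noteq> 0" "f = Fraction_Field.Fract P Q"
      "\<forall>x\<in>coord_space V. eval_poly x Q \<noteq> 0 \<longrightarrow> g x = eval_poly x P / eval_poly x Q"
    and PQ': "poly_in V P'" "poly_in V Q'" "Q' \<noteq> 0" "f' = Fraction_Field.Fract P' Q'"
      "\<forall>x\<in>coord_space V. eval_poly x Q' \<noteq> 0 \<longrightarrow> g' x = eval_poly x P' / eval_poly x Q'"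
    using assms unfolding represents_def by blast
  show ?thesis unfolding represents_def
    by (intro exI[of _ "P * Q' + P' * Q"] exI[of _ "Q * Q'"] conjI)
      (use PQ PQ' in \<open>auto simp: poly_in_add poly_in_mult eval_poly_add eval_poly_mult add_frac_eq\<close>)
qed

lemma represents_mult:
  assumes "represents V f g" "represents V f' g'"
  shows "represents V (f * f') (\<lambda>x. g x * g' x)"
proof -
  obtain P Q P' Q' where PQ: "poly_in V P" "poly_in V Q" "Q \<noteq> 0" "f = Fraction_Field.Fract P Q"
      "\<forall>x\<in>coord_space V. eval_poly x Q \<noteq> 0 \<longrightarrow> g x = eval_poly x P / eval_poly x Q"
    and PQ': "poly_in V P'" "poly_in V Q'" "Q' \<noteq> 0" "f' = Fraction_Field.Fract P' Q'"
      "\<forall>x\<in>coord_space V. eval_poly x Q' \<noteq> 0 \<longrightarrow> g' x = eval_poly x P' / eval_poly x Q'"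
    using assms unfolding represents_def by blast
  show ?thesis unfolding represents_def
    by (intro exI[of _ "P * P'"] exI[of _ "Q * Q'"] conjI)
      (use PQ PQ' in \<open>auto simp: poly_in_mult eval_poly_mult\<close>)
qed

lemma represents_sum:
  assumes "\<And>s. s \<in> S \<Longrightarrow> represents V (f s) (g s)"
  shows "represents V (\<Sum>s\<in>S. f s) (\<lambda>x. \<Sum>s\<in>S. g s x)"
proof -
  have zero: "represents V 0 (\<lambda>x. 0)" using represents_const[of V 0] by simp
  show ?thesis
    using assms by (induction S rule: infinite_finite_induct) (simp_all add: zero represents_add)
qed

subsection \<open>Tensor-tensor multiplication\<close>

lemma TM_index_iff: "(i, j, l) \<in> TM_index p n \<longleftrightarrow> i < n \<and> j < n \<and> l < p"
  by (simp add: TM_index_def tensor_index_def)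

lemma finite_TM_index: "finite (TM_index p n)"
  by (simp add: TM_index_def tensor_index_def)

text \<open>Fewer than m^2 forms \<open>\<alpha> t\<close> have a common nonzero zero v in the space
  of m x m matrices, so v times any matrix is 0. Multiplying v by the matrix unit at (c, 0) and
  reading the entry (e, 0) returns the entry (e, c) of v, a contradiction.\<close>

lemma mm_decomposition_lower_bound:
  assumes dec: "mm_decomposition m r \<alpha> \<beta> (w :: nat \<Rightarrow> nat \<Rightarrow> nat \<Rightarrow> 'k::field)"
  shows "m\<^sup>2 \<le> r"
proof (rule ccontr)
  assume "\<not> m\<^sup>2 \<le> r"
  then have r: "r < m * m" by (simp add: power2_eq_square)
  \<comment> \<open>The r forms are padded with zero rows to a square matrix. Row r is one of them,
    so the unit vector r is in the kernel of the transpose and D is singular.\<close>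
  define D where "D = mat (m * m) (m * m) (\<lambda>(t, s). if t < r then \<alpha> t (s div m) (s mod m) else 0)"
  have D: "D \<in> carrier_mat (m * m) (m * m)" by (simp add: D_def)
  have "transpose_mat D *\<^sub>v unit_vec (m * m) r = 0\<^sub>v (m * m)"
    using r by (intro eq_vecI) (auto simp: D_def)
  moreover have "unit_vec (m * m) r \<noteq> (0\<^sub>v (m * m) :: 'k vec)"
    using r by (metis index_unit_vec(2) index_zero_vec(1) zero_neq_one)
  ultimately have "det (transpose_mat D) = 0"
    using det_0_iff_vec_prod_zero_field[of "transpose_mat D" "m * m"] D
    by (metis transpose_carrier_mat unit_vec_carrier)
  then obtain v where v: "v \<in> carrier_vec (m * m)" "v \<noteq> 0\<^sub>v (m * m)" "D *\<^sub>v v = 0\<^sub>v (m * m)"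
    using det_transpose[OF D] det_0_iff_vec_prod_zero_field[OF D] by auto
  have zero: "(\<Sum>a<m. \<Sum>b<m. \<alpha> t a b * v $ (a * m + b)) = 0" if t: "t < r" for t
  proof -
    have "(D *\<^sub>v v) $ t = (\<Sum>s<m * m. \<alpha> t (s div m) (s mod m) * v $ s)"
      using v(1) t r by (simp add: D_def scalar_prod_def atLeast0LessThan)
    also have "\<dots> = (\<Sum>a<m. \<Sum>b<m. \<alpha> t a b * v $ (a * m + b))"
      by (subst sum_lessThan_mult) (auto intro!: sum.cong)
    finally show ?thesis using v(3) t r by simp
  qed
  have "v $ s = 0" if s: "s < m * m" for s
  proof -
    let ?e = "s div m" and ?c = "s mod m"
    have "0 < m" using s by (cases m) auto
    with s have m: "0 < m" "?e < m" "?c < m" by (auto simp: less_mult_imp_div_less)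
    have "(\<Sum>t<r. (\<Sum>a<m. \<Sum>b<m. \<alpha> t a b * v $ (a * m + b)) * \<beta> t ?c 0 * w t ?e 0) = 0"
      using zero by simp
    also have "(\<Sum>t<r. (\<Sum>a<m. \<Sum>b<m. \<alpha> t a b * v $ (a * m + b)) * \<beta> t ?c 0 * w t ?e 0)
        = (\<Sum>t<r. \<Sum>a<m. \<Sum>b<m. \<alpha> t a b * \<beta> t ?c 0 * w t ?e 0 * v $ (a * m + b))"
      by (simp add: sum_distrib_right sum_distrib_left mult_ac)
    also have "\<dots> = (\<Sum>a<m. \<Sum>b<m. (\<Sum>t<r. \<alpha> t a b * \<beta> t ?c 0 * w t ?e 0) * v $ (a * m + b))"
      by (simp only: sum.swap[of _ _ "{..<r}"] sum_distrib_right)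
    also have "\<dots> = (\<Sum>a<m. \<Sum>b<m. if b = ?c then if a = ?e then v $ (a * m + b) else 0 else 0)"
      using dec m by (intro sum.cong refl) (auto simp: mm_decomposition_def)
    also have "\<dots> = v $ s" using m by simp
    finally show ?thesis by simp
  qed
  then have "v = 0\<^sub>v (m * m)" using v(1) by (intro eq_vecI) auto
  with v(2) show False ..
qed

section \<open>Decompositions and programs for \<open>TM\<close>, given a right inverse of
  \<open>M\<close>\<close>

context
  fixes M :: "'k::{conjugatable_field, field_char_0} mat" and p q :: nat
  assumes M: "M \<in> carrier_mat q p" and N: "moore_penrose M \<in> carrier_mat p q"
    and MN: "M * moore_penrose M = 1\<^sub>m q"
begin

lemma TM_entry:
  "TM M n A B (i, j, l) = (if i < n \<and> j < n \<and> l < p then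
     \<Sum>k<q. moore_penrose M $$ (l, k) *
       (\<Sum>s<n. (\<Sum>a<p. M $$ (k, a) * A (i, s, a)) * (\<Sum>b<p. M $$ (k, b) * B (s, j, b)))
   else 0)"
proof -
  have mode: "mode3_product A M (i, j, k) = (\<Sum>a<p. M $$ (k, a) * A (i, j, a))"
    if "k < q" for A i j k
    using M that by (simp add: mode3_product_def)
  have face: "facewise_product n n n A B (i, j, k)
      = (if i < n \<and> j < n then \<Sum>s<n. A (i, s, k) * B (s, j, k) else 0)"
    for A B :: "'k tensor" and i j k
    by (simp add: facewise_product_def frontal_slice_def scalar_prod_def atLeast0LessThan)
  have "TM M n A B (i, j, l) = (if l < p then \<Sum>k<q. moore_penrose M $$ (l, k) *
      facewise_product n n n (mode3_product A M) (mode3_product B M) (i, j, k) else 0)"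
    unfolding TM_def tensor_mult_def using N
    by (subst mode3_product_def) (simp only: carrier_matD split_conv if_True)
  then show ?thesis
    by (cases "i < n"; cases "j < n") (simp_all add: face mode cong: sum.cong_simp)
qed

lemma TM_coord_space: "TM M n A B \<in> coord_space (TM_index p n)"
  by (auto simp: coord_space_def TM_entry TM_index_iff)

lemma M_pinv_entry:
  assumes "k < q" "k' < q"
  shows "(\<Sum>l<p. M $$ (k, l) * moore_penrose M $$ (l, k')) = (if k = k' then 1 else 0)"
proof -
  have "(M * moore_penrose M) $$ (k, k') = (\<Sum>l<p. M $$ (k, l) * moore_penrose M $$ (l, k'))"
    using M N assms by (simp add: scalar_prod_def atLeast0LessThan)
  then show ?thesis using assms by (simp add: MN)
qed

lemma TM_bilinear: "bilinear_on I J (TM M n)"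
proof -
  define h where "h A k i j = (\<Sum>a<p. M $$ (k, a) * A (i, j, a))" for A :: "'k tensor" and k i j
  have h: "h (A + B) k i j = h A k i j + h B k i j" "h (coord_scale c A) k i j = c * h A k i j"
    for A B c k i j
    by (simp_all add: h_def coord_scale_def algebra_simps sum.distrib sum_distrib_left)
  have "linear_form_on coord_scale U (\<lambda>A. TM M n A B (i, j, l))"
    "linear_form_on coord_scale U (\<lambda>A. TM M n B A (i, j, l))" for U B i j l
    unfolding linear_form_on_def TM_entry h_def[symmetric] h
    by (auto simp: algebra_simps sum.distrib sum_distrib_left)
  then show ?thesis unfolding bilinear_on_def split_paired_all by simp
qed

text \<open>The standard algorithm, with q n^3 products. It ensures that the minimum defining the
  rank is attained.\<close>

lemma TM_decomposition_exists:
  "\<exists>\<alpha> \<beta> w. bilinear_decomposition (TM_index p n) (TM_index p n) (TM_index p n) (TM M n)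
     ({..<q} \<times> {..<n} \<times> {..<n} \<times> {..<n}) \<alpha> \<beta> w"
proof -
  define \<alpha> where "\<alpha> = (\<lambda>(k::nat, i::nat, s::nat, j::nat) A. \<Sum>a<p. M $$ (k, a) * (A (i, s, a) :: 'k))"
  define \<beta> where "\<beta> = (\<lambda>(k::nat, i::nat, s::nat, j::nat) B. \<Sum>b<p. M $$ (k, b) * (B (s, j, b) :: 'k))"
  define w where "w = (\<lambda>(k::nat, i::nat, s::nat, j::nat) (i', j', l).
    if i' = i \<and> j' = j \<and> l < p then moore_penrose M $$ (l, k) else 0)"
  have "bilinear_decomposition (TM_index p n) (TM_index p n) (TM_index p n) (TM M n)
     ({..<q} \<times> {..<n} \<times> {..<n} \<times> {..<n}) \<alpha> \<beta> w"
    unfolding bilinear_decomposition_def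
  proof (intro conjI ballI)
    fix s assume s: "s \<in> {..<q} \<times> {..<n} \<times> {..<n} \<times> {..<n}"
    show "linear_form_on coord_scale (coord_space (TM_index p n)) (\<alpha> s)"
      "linear_form_on coord_scale (coord_space (TM_index p n)) (\<beta> s)"
      by (auto simp: linear_form_on_def \<alpha>_def \<beta>_def coord_scale_def split_beta algebra_simps
          sum.distrib sum_distrib_left)
    show "w s \<in> coord_space (TM_index p n)"
      using s by (auto simp: coord_space_def w_def TM_index_iff)
  next
    fix A B :: "'k tensor"
    show "TM M n A B = (\<Sum>s\<in>{..<q} \<times> {..<n} \<times> {..<n} \<times> {..<n}. coord_scale (\<alpha> s A * \<beta> s B) (w s))"
    proof
      fix x :: "nat \<times> nat \<times> nat"
      obtain i j l where x: "x = (i, j, l)" by (cases x) auto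
      let ?h = "\<lambda>k s. (\<Sum>a<p. M $$ (k, a) * A (i, s, a)) * (\<Sum>b<p. M $$ (k, b) * B (s, j, b))"
      have "(\<Sum>s\<in>{..<q} \<times> {..<n} \<times> {..<n} \<times> {..<n}. coord_scale (\<alpha> s A * \<beta> s B) (w s)) x
        = (\<Sum>k<q. \<Sum>i'<n. \<Sum>s<n. \<Sum>j'<n. \<alpha> (k, i', s, j') A * \<beta> (k, i', s, j') B * w (k, i', s, j') x)"
        by (simp add: sum_fun_apply coord_scale_def sum.cartesian_product split_def)
      also have "\<dots> = (\<Sum>k<q. \<Sum>i'<n. \<Sum>s<n. \<Sum>j'<n. if j' = j then if i' = i then if l < p then
          moore_penrose M $$ (l, k) * ?h k s else 0 else 0 else 0)"
        by (intro sum.cong refl) (auto simp: \<alpha>_def \<beta>_def w_def x)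
      also have "\<dots> = (\<Sum>k<q. \<Sum>s<n. \<Sum>i'<n. \<Sum>j'<n. if j' = j then if i' = i then if l < p then
          moore_penrose M $$ (l, k) * ?h k s else 0 else 0 else 0)"
        by (intro sum.cong refl sum.swap)
      also have "\<dots> = TM M n A B x"
        by (cases "i < n"; cases "j < n"; cases "l < p") (simp_all add: x TM_entry sum_distrib_left)
      finally show "TM M n A B x
        = (\<Sum>s\<in>{..<q} \<times> {..<n} \<times> {..<n} \<times> {..<n}. coord_scale (\<alpha> s A * \<beta> s B) (w s)) x" ..
    qed
  qed
  then show ?thesis by blast
qed

text \<open>Matrix multiplication is the restriction of \<open>TM\<close> to tensors whose transform under \<open>M\<close> is
  concentrated in the slice \<open>0\<close>.\<close>

lemma mm_decomposition_of_TM: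
  assumes dec: "bilinear_decomposition (TM_index p n) (TM_index p n) (TM_index p n) (TM M n)
      {..<r} \<alpha> \<beta> w" and q: "0 < q"
  shows "\<exists>\<alpha>' \<beta>' w'. mm_decomposition n r \<alpha>' \<beta>' (w' :: nat \<Rightarrow> nat \<Rightarrow> nat \<Rightarrow> 'k)"
proof -
  \<comment> \<open>The matrix unit at (a, b), placed in slice 0 and pulled back by M^+. Since M M^+
    = 1, its transform under M is this matrix unit in slice 0 and zero in all other slices.\<close>
  define E where "E a b = (\<lambda>(i, j, l). if i = a \<and> j = b \<and> l < p then moore_penrose M $$ (l, 0) else 0)"
    for a b :: nat
  have E: "E a b \<in> coord_space (TM_index p n)" if "a < n" "b < n" for a b
    using that by (auto simp: coord_space_def E_def TM_index_iff)
  have hat: "(\<Sum>l<p. M $$ (k, l) * E a b (i, s, l)) = (if i = a \<and> s = b \<and> k = 0 then 1 else 0)"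
    if "k < q" for k a b i s
    using M_pinv_entry[OF that q] by (cases "i = a \<and> s = b") (auto simp: E_def)
  have TME: "TM M n (E a b) (E c d) (e, f, l)
      = (if a = e \<and> b = c \<and> d = f then moore_penrose M $$ (l, 0) else 0)"
    if "b < n" "e < n" "f < n" "l < p" for a b c d e f l
  proof -
    have "TM M n (E a b) (E c d) (e, f, l) = (\<Sum>k<q. moore_penrose M $$ (l, k) *
        (\<Sum>s<n. (\<Sum>a'<p. M $$ (k, a') * E a b (e, s, a')) * (\<Sum>b'<p. M $$ (k, b') * E c d (s, f, b'))))"
      using that by (simp add: TM_entry)
    also have "\<dots> = (\<Sum>k<q. moore_penrose M $$ (l, k) *
        (\<Sum>s<n. if s = b then if a = e \<and> b = c \<and> d = f \<and> k = 0 then 1 else 0 else 0))"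
      by (intro sum.cong refl arg_cong2[where f = "(*)"]) (auto simp: hat)
    also have "\<dots> = (\<Sum>k<q. if k = 0 then
        if a = e \<and> b = c \<and> d = f then moore_penrose M $$ (l, 0) else 0 else 0)"
      using that by (intro sum.cong) auto
    finally show ?thesis using q by simp
  qed
  \<comment> \<open>The tube (e, f) of a product of such tensors is the entry of the matrix product
    times column 0 of M^+. Row 0 of M sends this column to 1, so it reads off the entry.\<close>
  have "mm_decomposition n r (\<lambda>t a b. \<alpha> t (E a b)) (\<lambda>t c d. \<beta> t (E c d))
      (\<lambda>t e f. \<Sum>l<p. M $$ (0, l) * w t (e, f, l))"
    unfolding mm_decomposition_def
  proof (intro allI impI)
    fix a b c d e f assume lt: "a < n" "b < n" "c < n" "d < n" "e < n" "f < n"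
    have "TM M n (E a b) (E c d)
        = (\<Sum>t<r. coord_scale (\<alpha> t (E a b) * \<beta> t (E c d)) (w t))"
      using dec E lt unfolding bilinear_decomposition_def by blast
    then have "(\<Sum>l<p. M $$ (0, l) * TM M n (E a b) (E c d) (e, f, l))
        = (\<Sum>l<p. \<Sum>t<r. \<alpha> t (E a b) * \<beta> t (E c d) * (M $$ (0, l) * w t (e, f, l)))"
      by (simp add: sum_fun_apply coord_scale_def sum_distrib_left mult_ac)
    also have "\<dots> = (\<Sum>t<r. \<alpha> t (E a b) * \<beta> t (E c d) * (\<Sum>l<p. M $$ (0, l) * w t (e, f, l)))"
      by (subst sum.swap) (simp add: sum_distrib_left)
    finally have "(\<Sum>l<p. M $$ (0, l) * TM M n (E a b) (E c d) (e, f, l))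
        = (\<Sum>t<r. \<alpha> t (E a b) * \<beta> t (E c d) * (\<Sum>l<p. M $$ (0, l) * w t (e, f, l)))" .
    moreover have "(\<Sum>l<p. M $$ (0, l) * TM M n (E a b) (E c d) (e, f, l))
        = (if a = e \<and> b = c \<and> d = f then 1 else 0)"
      using M_pinv_entry[OF q q] lt
      by (cases "a = e \<and> b = c \<and> d = f") (auto simp: TME cong: sum.cong_simp)
    ultimately show "(\<Sum>t<r. \<alpha> t (E a b) * \<beta> t (E c d) * (\<Sum>l<p. M $$ (0, l) * w t (e, f, l)))
        = (if a = e \<and> b = c \<and> d = f then 1 else 0)"
      by (rule trans[OF sym])
  qed
  then show ?thesis by blast
qed

text \<open>The transforms of both operands have q n^2 entries with p terms each, and the transform
  back has p n^2 entries with q terms each. At two operations per term, each of the three costs 2 p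
  q n^2; the q face products cost c each.\<close>

lemma TM_slp:
  assumes mm: "mm_computable (pair_coords (TM_index p n) (TM_index p n)) TYPE('k) n c"
  obtains P where "length P \<le> q * c + 6 * p * q * n\<^sup>2"
    "slp_computes (pair_coords (TM_index p n) (TM_index p n)) (TM_index p n) P
       (map_on_pair (TM M n))"
proof -
  let ?V = "pair_coords (TM_index p n) (TM_index p n)"
  let ?X = "rat_var ` ?V :: (_, 'k) rational_function set"
  define S :: "nat \<Rightarrow> nat \<Rightarrow> nat \<Rightarrow>
      ((nat \<times> nat \<times> nat, nat \<times> nat \<times> nat) pair_coord, 'k) rational_function"
    where "S = (\<lambda>k i s. \<Sum>a<p. rat_const (M $$ (k, a)) * rat_var (Fst_Coord (i, s, a)))"
  define T :: "nat \<Rightarrow> nat \<Rightarrow> nat \<Rightarrow>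
      ((nat \<times> nat \<times> nat, nat \<times> nat \<times> nat) pair_coord, 'k) rational_function"
    where "T = (\<lambda>k s j. \<Sum>b<p. rat_const (M $$ (k, b)) * rat_var (Snd_Coord (s, j, b)))"
  define Q where "Q k i j = (\<Sum>s<n. S k i s * T k s j)" for k i j
  define C where "C i j l = (\<Sum>k<q. rat_const (moore_penrose M $$ (l, k)) * Q k i j)" for i j l
  let ?I = "{..<q} \<times> {..<n} \<times> {..<n}"
  define Y1 where "Y1 = (\<lambda>(k, i, j). S k i j) ` ?I"
  define Y2 where "Y2 = (\<lambda>(k, i, j). T k i j) ` ?I"
  define Y3 where "Y3 = (\<Union>k<q. (\<lambda>(i, j). Q k i j) ` ({..<n} \<times> {..<n}))"
  define Y4 where "Y4 = (\<lambda>(i, j, l). C i j l) ` ({..<n} \<times> {..<n} \<times> {..<p})"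
  have "computable ?V ?X (card ?I * (2 * card {..<p})) Y1"
    unfolding Y1_def
  proof (rule computable_image)
    fix x assume x: "x \<in> ?I"
    obtain k i s where x_eq: "x = (k, i, s)" by (cases x) auto
    have "(\<lambda>a. rat_var (Fst_Coord (i, s, a))) ` {..<p} \<subseteq> ?X"
      using x by (auto simp: x_eq pair_coords_def TM_index_iff)
    from computable_linear_combination[OF _ this, of ?V "\<lambda>a. M $$ (k, a)"]
    show "computable ?V ?X (2 * card {..<p}) {case x of (k, i, s) \<Rightarrow> S k i s}"
      by (simp add: S_def x_eq)
  qed simp
  moreover have "computable ?V ?X (card ?I * (2 * card {..<p})) Y2"
    unfolding Y2_def
  proof (rule computable_image)
    fix x assume x: "x \<in> ?I"
    obtain k s j where x_eq: "x = (k, s, j)" by (cases x) auto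
    have "(\<lambda>b. rat_var (Snd_Coord (s, j, b))) ` {..<p} \<subseteq> ?X"
      using x by (auto simp: x_eq pair_coords_def TM_index_iff)
    from computable_linear_combination[OF _ this, of ?V "\<lambda>b. M $$ (k, b)"]
    show "computable ?V ?X (2 * card {..<p}) {case x of (k, s, j) \<Rightarrow> T k s j}"
      by (simp add: T_def x_eq)
  qed simp
  ultimately have 12: "computable ?V ?X (card ?I * (2 * card {..<p}) +
      card ?I * (2 * card {..<p})) (Y1 \<union> Y2)"
    by (rule computable_Un)
  have 3: "computable ?V (?X \<union> (Y1 \<union> Y2)) (\<Sum>k<q. c) Y3"
    unfolding Y3_def
  proof (rule computable_UN)
    fix k assume "k \<in> {..<q}"
    then have "\<forall>i<n. \<forall>j<n. S k i j \<in> ?X \<union> (Y1 \<union> Y2) \<and> T k i j \<in> ?X \<union> (Y1 \<union> Y2)"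
      unfolding Y1_def Y2_def by force
    then show "computable ?V (?X \<union> (Y1 \<union> Y2)) c ((\<lambda>(i, j). Q k i j) ` ({..<n} \<times> {..<n}))"
      using mm unfolding mm_computable_def Q_def by blast
  qed simp
  have 4: "computable ?V (?X \<union> ((Y1 \<union> Y2) \<union> Y3))
      (card ({..<n} \<times> {..<n} \<times> {..<p}) * (2 * card {..<q})) Y4"
    unfolding Y4_def
  proof (rule computable_image)
    fix x assume x: "x \<in> {..<n} \<times> {..<n} \<times> {..<p}"
    obtain i j l where x_eq: "x = (i, j, l)" by (cases x) auto
    have "(\<lambda>k. Q k i j) ` {..<q} \<subseteq> ?X \<union> ((Y1 \<union> Y2) \<union> Y3)"
      using x unfolding Y3_def x_eq by force
    from computable_linear_combination[OF _ this, of ?V "\<lambda>k. moore_penrose M $$ (l, k)"]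
    show "computable ?V (?X \<union> ((Y1 \<union> Y2) \<union> Y3)) (2 * card {..<q})
        {case x of (i, j, l) \<Rightarrow> C i j l}"
      by (simp add: C_def x_eq)
  qed simp
  have "computable ?V ?X (card ?I * (2 * card {..<p}) + card ?I * (2 * card {..<p}) + (\<Sum>k<q. c) +
      card ({..<n} \<times> {..<n} \<times> {..<p}) * (2 * card {..<q})) (((Y1 \<union> Y2) \<union> Y3) \<union> Y4)"
    by (rule computable_trans[OF computable_trans[OF 12] 4])
      (use 3 in \<open>simp add: Un_assoc\<close>)
  then have "computable ?V ?X (q * c + 6 * p * q * n\<^sup>2) Y4"
    by (rule computable_mono) (auto simp: card_cartesian_product power2_eq_square algebra_simps)
  moreover have "?X \<subseteq> available ?V []"
    unfolding available_def by (auto intro!: exI[of _ "Input _"])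
  ultimately obtain P rs where P: "slp_results ?V ([] @ P) ([] @ rs)"
      "length P \<le> q * c + 6 * p * q * n\<^sup>2" "Y4 \<subseteq> available ?V ([] @ rs)"
    using slp_Nil[of ?V] unfolding computable_def by blast
  have "\<exists>a. operand_ok ?V (length rs) a \<and> represents ?V (operand_val rs a)
      (\<lambda>x. map_on_pair (TM M n) x (i, j, l))" if "i < n" "j < n" "l < p" for i j l
  proof -
    have "C i j l \<in> Y4" using that unfolding Y4_def by force
    then obtain a where a: "operand_ok ?V (length rs) a" "C i j l = operand_val rs a"
      using P(3) unfolding available_def by auto
    have "represents ?V (C i j l) (\<lambda>x. \<Sum>k<q. moore_penrose M $$ (l, k) *
       (\<Sum>s<n. (\<Sum>a<p. M $$ (k, a) * x (Fst_Coord (i, s, a))) *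
         (\<Sum>b<p. M $$ (k, b) * x (Snd_Coord (s, j, b)))))"
      unfolding C_def Q_def S_def T_def using that
      by (intro represents_sum represents_mult represents_const represents_var)
        (auto simp: pair_coords_def TM_index_iff)
    then have "represents ?V (operand_val rs a) (\<lambda>x. map_on_pair (TM M n) x (i, j, l))"
      unfolding a(2)[symmetric] using that by (simp add: map_on_pair_def TM_entry)
    with a(1) show ?thesis by blast
  qed
  then have "slp_computes ?V (TM_index p n) P (map_on_pair (TM M n))"
    using P(1) unfolding slp_computes_def
    by (auto simp: TM_index_iff intro!: exI[of _ rs])
  with P(2) show thesis using that by blast
qed

end

subsection \<open>Comparison of growth exponents\<close>

text \<open>A loss of \<epsilon> in one direction is harmless since it is arbitrary and the
  exponents are infima.\<close>

lemma growth_exponent_eqI: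
  assumes fg: "\<And>\<tau>. (\<lambda>n. real (f n)) \<in> O(\<lambda>n. real n powr \<tau>) \<Longrightarrow> (\<lambda>n. real (g n)) \<in> O(\<lambda>n. real n powr \<tau>)"
    and gf: "\<And>\<tau> \<epsilon>. 0 < \<epsilon> \<Longrightarrow> (\<lambda>n. real (g n)) \<in> O(\<lambda>n. real n powr \<tau>) \<Longrightarrow>
      (\<lambda>n. real (f n)) \<in> O(\<lambda>n. real n powr (\<tau> + \<epsilon>))"
  shows "growth_exponent f = growth_exponent g"
proof (rule antisym)
  show "growth_exponent f \<le> growth_exponent g"
    unfolding growth_exponent_def[of g]
  proof (rule Inf_greatest, clarify)
    fix \<tau> assume g: "(\<lambda>n. real (g n)) \<in> O(\<lambda>n. real n powr \<tau>)"
    show "growth_exponent f \<le> ereal \<tau>"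
    proof (rule ereal_le_epsilon2)
      fix \<epsilon> :: real assume "0 < \<epsilon>"
      from gf[OF this g] show "growth_exponent f \<le> ereal \<tau> + ereal \<epsilon>"
        unfolding growth_exponent_def by (intro Inf_lower) auto
    qed
  qed
  show "growth_exponent g \<le> growth_exponent f"
    unfolding growth_exponent_def by (rule Inf_superset_mono) (use fg in blast)
qed

text \<open>The recursion is c' = r c + E m^(2k). Adding the potential E m^(2k) to the cost makes it
  geometric: the new sum is r c + (m^2 + 1) E m^(2k), at most \<rho> times the old one. This is the
  origin of the bound m^2 + 1 on \<rho>.\<close>

lemma mm_computable_power:
  fixes V :: "'v::linorder set"
  assumes dec: "mm_decomposition m r \<alpha> \<beta> (w :: nat \<Rightarrow> nat \<Rightarrow> nat \<Rightarrow> 'k::field)"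
    and \<rho>: "r \<le> \<rho>" "m\<^sup>2 + 1 \<le> \<rho>"
  defines "E \<equiv> 6 * r * m\<^sup>2"
  shows "\<exists>c. mm_computable V TYPE('k) (m ^ k) c \<and> c + E * (m ^ k)\<^sup>2 \<le> (1 + E) * \<rho> ^ k"
proof (induction k)
  case 0
  show ?case using mm_computable_1[of V "TYPE('k)"] by (intro exI[of _ 1]) simp
next
  case (Suc k)
  then obtain c where c: "mm_computable V TYPE('k) (m ^ k) c"
    and bound: "c + E * (m ^ k)\<^sup>2 \<le> (1 + E) * \<rho> ^ k" by blast
  have "r * c + E * (m ^ k)\<^sup>2 + E * (m ^ Suc k)\<^sup>2 = r * c + (m\<^sup>2 + 1) * (E * (m ^ k)\<^sup>2)"
    by (simp add: power_mult_distrib algebra_simps)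
  also have "\<dots> \<le> \<rho> * c + \<rho> * (E * (m ^ k)\<^sup>2)"
    using \<rho> by (intro add_mono mult_right_mono) auto
  also have "\<dots> = \<rho> * (c + E * (m ^ k)\<^sup>2)" by (simp add: algebra_simps)
  also have "\<dots> \<le> \<rho> * ((1 + E) * \<rho> ^ k)" using bound by (intro mult_left_mono) auto
  also have "\<dots> = (1 + E) * \<rho> ^ Suc k" by (simp add: algebra_simps)
  finally show ?case
    using mm_computable_step[OF dec c] by (auto simp: E_def)
qed

lemma exponent_ge_2:
  assumes "\<And>n. n\<^sup>2 \<le> f n" "(\<lambda>n. real (f n)) \<in> O(\<lambda>n. real n powr \<tau>)"
  shows "2 \<le> \<tau>"
proof (rule ccontr)
  assume "\<not> 2 \<le> \<tau>"
  obtain C where C: "\<forall>\<^sub>F n in sequentially. norm (real (f n)) \<le> C * norm (real n powr \<tau>)"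
    using assms(2) by (elim landau_o.bigE)
  from \<open>\<not> 2 \<le> \<tau>\<close> have "filterlim (\<lambda>n. real n powr (2 - \<tau>)) at_top sequentially"
    by real_asymp
  then have "\<forall>\<^sub>F n in sequentially. C < real n powr (2 - \<tau>)"
    by (simp add: filterlim_at_top_dense)
  then have "\<forall>\<^sub>F n in sequentially. False"
    using C eventually_gt_at_top[of 0]
  proof eventually_elim
    case (elim n)
    have "real n powr (2 - \<tau>) * real n powr \<tau> = real (n\<^sup>2)"
      using elim(3) by (simp flip: powr_add)
    also have "\<dots> \<le> real (f n)" using assms(1) of_nat_le_iff by blast
    also have "\<dots> \<le> C * real n powr \<tau>" using elim(2) by simp
    finally have "real n powr (2 - \<tau>) \<le> C" using elim(3) by simp
    with elim(1) show False by simp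
  qed
  then show False by simp
qed

section \<open>Comparison of rank and complexity of \<open>TM\<close>\<close>

context
  fixes M :: "'k::{conjugatable_field, field_char_0} mat" and p q :: nat
  assumes M: "M \<in> carrier_mat q p" and N: "moore_penrose M \<in> carrier_mat p q"
    and MN: "M * moore_penrose M = 1\<^sub>m q" and q: "0 < q"
begin

abbreviation "TM_rank n \<equiv> coord_rank (TM_index p n) (TM_index p n) (TM_index p n) (TM M n)"

abbreviation "TM_complexity n \<equiv>
  total_complexity (pair_coords (TM_index p n) (TM_index p n)) (TM_index p n) (map_on_pair (TM M n))"

lemma mm_decomposition_TM_rank:
  obtains \<alpha> \<beta> w where "mm_decomposition n (TM_rank n) \<alpha> \<beta> (w :: nat \<Rightarrow> nat \<Rightarrow> nat \<Rightarrow> 'k)"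
proof -
  obtain \<alpha> \<beta> w where "bilinear_decomposition (TM_index p n) (TM_index p n) (TM_index p n) (TM M n)
     ({..<q} \<times> {..<n} \<times> {..<n} \<times> {..<n}) \<alpha> \<beta> w"
    using TM_decomposition_exists[OF M N MN] by blast
  then obtain \<alpha>' \<beta>' w' where
    "bilinear_decomposition (TM_index p n) (TM_index p n) (TM_index p n) (TM M n)
       {..<TM_rank n} \<alpha>' \<beta>' w'"
    by (rule coord_rank_decomposition) simp
  from mm_decomposition_of_TM[OF M N MN this q] that show thesis by blast
qed

lemma TM_rank_lower_bound: "n\<^sup>2 \<le> TM_rank n"
  by (rule mm_decomposition_TM_rank) (rule mm_decomposition_lower_bound)

lemma TM_complexity_le:
  assumes "mm_computable (pair_coords (TM_index p n) (TM_index p n)) TYPE('k) n c"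
  shows "TM_complexity n \<le> q * c + 6 * p * q * n\<^sup>2"
proof -
  obtain P where P: "length P \<le> q * c + 6 * p * q * n\<^sup>2"
    "slp_computes (pair_coords (TM_index p n) (TM_index p n)) (TM_index p n) P
       (map_on_pair (TM M n))"
    using TM_slp[OF M N MN assms] .
  have "TM_complexity n \<le> length P"
    unfolding total_complexity_def by (rule Least_le) (use P(2) in blast)
  with P(1) show ?thesis by simp
qed

lemma TM_rank_le_complexity: "TM_rank n \<le> 2 * TM_complexity n"
proof -
  let ?V = "pair_coords (TM_index p n) (TM_index p n)"
  \<comment> \<open>Some program must exist before the minimum in \<open>total_complexity\<close>
    can be used. One recursion step with blocks of size 1 turns a decomposition into such a
    program.\<close>
  obtain \<alpha> \<beta> w where "mm_decomposition n (TM_rank n) \<alpha> \<beta> (w :: nat \<Rightarrow> nat \<Rightarrow> nat \<Rightarrow> 'k)"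
    by (rule mm_decomposition_TM_rank)
  from mm_computable_step[OF this mm_computable_1] obtain c
    where "mm_computable ?V TYPE('k) n c" by auto
  then obtain P0 where "slp_computes ?V (TM_index p n) P0 (map_on_pair (TM M n))"
    using TM_slp[OF M N MN] by metis
  then have "\<exists>r P. length P = r \<and> slp_computes ?V (TM_index p n) P (map_on_pair (TM M n))"
    by blast
  then have "\<exists>P. length P = TM_complexity n \<and>
      slp_computes ?V (TM_index p n) P (map_on_pair (TM M n))"
    unfolding total_complexity_def by (rule LeastI_ex)
  then obtain P where P: "length P = TM_complexity n"
    "slp_computes ?V (TM_index p n) P (map_on_pair (TM M n))" by blast
  obtain \<alpha> \<beta> w where "bilinear_decomposition (TM_index p n) (TM_index p n) (TM_index p n) (TM M n)
      ({..<length P} \<times> (UNIV :: bool set)) \<alpha> \<beta> w"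
    using slp_bilinear_decomposition[OF TM_bilinear[OF M N MN] finite_TM_index
        TM_coord_space[OF M N MN] P(2)] .
  then have "TM_rank n \<le> card ({..<length P} \<times> (UNIV :: bool set))"
    by (rule coord_rank_le) simp
  then show ?thesis using P(1) by (simp add: card_cartesian_product)
qed

lemma TM_complexity_bigo:
  assumes rank: "(\<lambda>n. real (TM_rank n)) \<in> O(\<lambda>n. real n powr \<tau>)" and \<epsilon>: "0 < \<epsilon>"
  shows "(\<lambda>n. real (TM_complexity n)) \<in> O(\<lambda>n. real n powr (\<tau> + \<epsilon>))"
proof -
  define \<sigma> where "\<sigma> = \<tau> + \<epsilon>"
  have \<tau>: "2 \<le> \<tau>" by (rule exponent_ge_2[OF TM_rank_lower_bound rank])
  obtain C where "\<forall>\<^sub>F n in sequentially. norm (real (TM_rank n)) \<le> C * norm (real n powr \<tau>)"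
    using rank by (elim landau_o.bigE)
  moreover from \<epsilon> have "filterlim (\<lambda>n. real n powr \<epsilon>) at_top sequentially"
    by real_asymp
  then have "\<forall>\<^sub>F n in sequentially. max C 2 \<le> real n powr \<epsilon>"
    unfolding filterlim_at_top by (rule spec)
  ultimately have "\<forall>\<^sub>F m in sequentially. 2 \<le> m \<and> max C 2 \<le> real m powr \<epsilon> \<and>
      real (TM_rank m) \<le> C * real m powr \<tau>"
    using eventually_ge_at_top[of 2] by eventually_elim simp
  \<comment> \<open>The factor m powr \<epsilon> pays for both parts of \<rho>: C for the rank, and
    2 for m^2 + 1 \<le> 2 m^2 \<le> 2 m powr \<tau>.\<close>
  then obtain m where m: "2 \<le> m" "max C 2 \<le> real m powr \<epsilon>"
    "real (TM_rank m) \<le> C * real m powr \<tau>"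
    using eventually_happens'[OF sequentially_bot] by blast
  define \<rho> where "\<rho> = max (TM_rank m) (m\<^sup>2 + 1)"
  have \<rho>: "real \<rho> \<le> real m powr \<sigma>"
  proof -
    have \<sigma>: "real m powr \<epsilon> * real m powr \<tau> = real m powr \<sigma>"
      by (simp add: \<sigma>_def add.commute flip: powr_add)
    have "C * real m powr \<tau> \<le> real m powr \<epsilon> * real m powr \<tau>"
      using m(2) by (intro mult_right_mono) auto
    then have 1: "real (TM_rank m) \<le> real m powr \<sigma>" using m(3) \<sigma> by simp
    have "1 \<le> (real m)\<^sup>2" using m(1) by (simp add: one_le_power)
    then have "real (m\<^sup>2 + 1) \<le> 2 * real m powr 2" using m(1) by simp
    also have "\<dots> \<le> real m powr \<epsilon> * real m powr \<tau>"
      using m(1,2) \<tau> by (intro mult_mono powr_mono) auto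
    finally have "real (m\<^sup>2 + 1) \<le> real m powr \<sigma>" unfolding \<sigma> .
    with 1 show ?thesis unfolding \<rho>_def of_nat_max by (rule max.boundedI)
  qed
  define E where "E = 6 * TM_rank m * m\<^sup>2"
  \<comment> \<open>The factor m powr \<sigma> accounts for rounding n up to a power of m, which is
    at most m n.\<close>
  define K where "K = real (q * (1 + E)) * real m powr \<sigma> + real (6 * p * q)"
  have "real (TM_complexity n) \<le> K * real n powr \<sigma>" if n: "1 \<le> n" for n
  proof -
    let ?V = "pair_coords (TM_index p n) (TM_index p n)"
    define k where "k = (LEAST k. n \<le> m ^ k)"
    have "n < 2 ^ n" by (rule less_exp)
    also have "\<dots> \<le> m ^ n" using m(1) by (rule power_mono) simp
    finally have "n \<le> m ^ n" by simp
    then have k: "n \<le> m ^ k" unfolding k_def by (rule LeastI)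
    have mk: "m ^ k \<le> m * n"
    proof (cases k)
      case 0
      then show ?thesis using m(1) n by simp
    next
      case (Suc j)
      \<comment> \<open>Minimality of k: the previous power is still below n, so one more factor m
        does not exceed m n.\<close>
      then have "\<not> n \<le> m ^ j" using not_less_Least[of j "\<lambda>k. n \<le> m ^ k"] by (simp add: k_def)
      then show ?thesis by (simp add: Suc)
    qed
    obtain \<alpha> \<beta> w where "mm_decomposition m (TM_rank m) \<alpha> \<beta> (w :: nat \<Rightarrow> nat \<Rightarrow> nat \<Rightarrow> 'k)"
      by (rule mm_decomposition_TM_rank)
    from mm_computable_power[OF this, of \<rho> ?V k] obtain c
      where c: "mm_computable ?V TYPE('k) (m ^ k) c" "c \<le> (1 + E) * \<rho> ^ k"
      by (auto simp: \<rho>_def E_def)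
    have "TM_complexity n \<le> q * c + 6 * p * q * n\<^sup>2"
      by (rule TM_complexity_le[OF mm_computable_pad[OF c(1) k]])
    also have "\<dots> \<le> q * ((1 + E) * \<rho> ^ k) + 6 * p * q * n\<^sup>2"
      using c(2) by (intro add_mono mult_left_mono) auto
    finally have "real (TM_complexity n) \<le> real (q * ((1 + E) * \<rho> ^ k) + 6 * p * q * n\<^sup>2)"
      by (rule of_nat_mono)
    also have "\<dots> = real (q * (1 + E)) * real \<rho> ^ k + real (6 * p * q) * (real n)\<^sup>2"
      by (simp add: algebra_simps)
    also have "\<dots> \<le> real (q * (1 + E)) * (real m powr \<sigma> * real n powr \<sigma>)
        + real (6 * p * q) * real n powr \<sigma>"
    proof (intro add_mono mult_left_mono)
      have "real \<rho> ^ k \<le> (real m powr \<sigma>) ^ k" using \<rho> by (intro power_mono) auto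
      also have "\<dots> = (real m ^ k) powr \<sigma>"
        using m(1) by (simp add: powr_power powr_powr mult.commute flip: powr_realpow)
      also have "\<dots> \<le> (real m * real n) powr \<sigma>"
        using mk \<tau> \<epsilon> by (intro powr_mono2) (simp_all add: \<sigma>_def flip: of_nat_power of_nat_mult)
      also have "\<dots> = real m powr \<sigma> * real n powr \<sigma>" by (simp add: powr_mult)
      finally show "real \<rho> ^ k \<le> real m powr \<sigma> * real n powr \<sigma>" .
      have "(real n)\<^sup>2 = real n powr 2" using n by simp
      also have "\<dots> \<le> real n powr \<sigma>" using n \<tau> \<epsilon> by (intro powr_mono) (auto simp: \<sigma>_def)
      finally show "(real n)\<^sup>2 \<le> real n powr \<sigma>" .
    qed auto
    also have "\<dots> = K * real n powr \<sigma>" by (simp add: K_def algebra_simps)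
    finally show ?thesis .
  qed
  then have "\<forall>\<^sub>F n in sequentially. norm (real (TM_complexity n)) \<le> K * norm (real n powr \<sigma>)"
    by (intro eventually_mono[OF eventually_ge_at_top[of 1]]) simp
  then show ?thesis unfolding \<sigma>_def[symmetric] by (rule bigoI)
qed

lemma TM_exponents_eq:
  "complexity_exponent (TM_index p) (TM_index p) (TM_index p) (TM M) =
   rank_exponent (TM_index p) (TM_index p) (TM_index p) (TM M)"
  unfolding complexity_exponent_def rank_exponent_def
proof (rule growth_exponent_eqI)
  fix \<tau> assume "(\<lambda>n. real (TM_complexity n)) \<in> O(\<lambda>n. real n powr \<tau>)"
  moreover have "(\<lambda>n. real (TM_rank n)) \<in> O(\<lambda>n. real (TM_complexity n))"
  proof (intro bigoI[of _ 2] always_eventually allI)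
    fix n
    show "norm (real (TM_rank n)) \<le> 2 * norm (real (TM_complexity n))"
      using of_nat_mono[OF TM_rank_le_complexity[of n], where 'a = real] by simp
  qed
  ultimately show "(\<lambda>n. real (TM_rank n)) \<in> O(\<lambda>n. real n powr \<tau>)"
    using landau_o.big_trans by blast
next
  fix \<tau> \<epsilon> :: real
  assume "0 < \<epsilon>" "(\<lambda>n. real (TM_rank n)) \<in> O(\<lambda>n. real n powr \<tau>)"
  then show "(\<lambda>n. real (TM_complexity n)) \<in> O(\<lambda>n. real n powr (\<tau> + \<epsilon>))"
    by (rule TM_complexity_bigo[rotated])
qed

end

theorem theorem3p2:
  fixes p q :: nat
  assumes "1 \<le> q" and "q \<le> p"
  shows
    "(\<forall>M :: real mat. M \<in> carrier_mat q p \<longrightarrow> vec_space.rank q M = q \<longrightarrow>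
        complexity_exponent (TM_index p) (TM_index p) (TM_index p) (TM M) =
        rank_exponent (TM_index p) (TM_index p) (TM_index p) (TM M)) \<and>
     (\<forall>M :: complex mat. M \<in> carrier_mat q p \<longrightarrow> vec_space.rank q M = q \<longrightarrow>
        complexity_exponent (TM_index p) (TM_index p) (TM_index p) (TM M) =
        rank_exponent (TM_index p) (TM_index p) (TM_index p) (TM M))"
  using assms(1) by (auto intro!: TM_exponents_eq moore_penrose_right_inverse)

end
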